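(* Let $\mathcal D\subset\mathbb C^2$ be an irreducible affine plane curve which is not a line, let $G(y_1,y_2,y_3)$ be the form defining its projective closure $\overline{\mathcal D}\subset\mathbb P^2$, and let $Z(\bar y_H,\bar u)\in\mathbb C[y_1,y_2,y_3,u_1,u_2]$ be homogeneous in $\bar y_H=(y_1,y_2,y_3)$ and depend on $y_3$. Suppose there is a non-empty Zariski open set $\Xi\subset\mathbb C^2$ such that for every $\bar\omega\in\Xi$: (1) $\deg_{\bar y_H}Z(\bar y_H,\bar\omega)=\deg_{\bar y_H}Z(\bar y_H,\bar u)$ (in particular $Z(\bar y_H,\bar\omega)$ is non-constant); let $\overline{\mathcal Z(\bar\omega)}\subset\mathbb P^2$ be the curve it defines; (2) $\overline{\mathcal Z(\bar\omega)}$ and $\overline{\mathcal D}$ have no common component; (3) setting $\mathcal G=\bigcap_{\bar u\in\Xi}\big(\overline{\mathcal Z(\bar u)}\cap\overline{\mathcal D}\big)$, for every $p\in(\overline{\mathcal Z(\bar\omega)}\cap\overline{\mathcal D})\setminus\mathcal G$ one has $\operatorname{mult}_p(\overline{\mathcal D},\overline{\mathcal Z(\bar\omega)})=1$; (4) writing $Z(\bar y_H,\bar u)=\sum_\alpha Z_\alpha(\bar y_H)\bar u^\alpha$ with $Z_\alpha\in\mathbb C[\bar y_H]$, and letting $\mathcal J_\alpha\subset\mathbb P^2$ be the zero set of $Z_\alpha$, one has $\bigcap_\alpha(\overline{\mathcal D}\cap\mathcal J_\alpha)\subset\mathcal G$; (5) $(0:0:1)\notin(\overline{\mathcal Z(\bar\omega)}\cap\overline{\mathcal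 D})\setminus\mathcal G$. Then there exists a non-empty Zariski open subset $\Xi^\star\subset\Xi$ such that for every $\bar\omega\in\Xi^\star$, $$\operatorname{Card}\big((\overline{\mathcal Z(\bar\omega)}\cap\overline{\mathcal D})\setminus\mathcal G\big)=\deg_{\{y_1,y_2\}}\Big(\operatorname{PP}_{\bar u}\big(\operatorname{Res}_{y_3}(G(\bar y_H),Z(\bar y_H,\bar u))\big)\Big).$$
   Context: $\bar u=(u_1,u_2)$. For $h\in\mathbb C[y_1,y_2,y_3,\bar u]$, $\operatorname{PP}_{\bar u}(h)$ denotes the primitive part of $h$ with respect to $\bar u$ (i.e. $h$ divided by its content, the gcd of its coefficients as a polynomial in $\bar u$ over $\mathbb C[y_1,y_2,y_3]$), and $\operatorname{Res}_{y_3}(h_1,h_2)$ is the resultant with respect to $y_3$. $\deg_{\{y_1,y_2\}}$ is the total degree in $y_1,y_2$. $\operatorname{mult}_p$ denotes intersection multiplicity of projective plane curves at $p$. *)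

theory Defs
  imports "Subresultants.Resultant_Prelim" "HOL-Computational_Algebra.Polynomial_Factorial" "HOL-Computational_Algebra.Field_as_Ring" "HOL-Library.Extended_Nat"
begin

text \<open>Conventions (innermost variable first):
  C[y1,y2]           : complex poly poly,            an element q is a polynomial in y2 whose
                       coefficients are polynomials in y1;
  C[y1,y2,y3]        : complex poly poly poly,       outer variable y3;
  C[y1,y2,u1,u2]     : complex poly poly poly poly,  variables (innermost to outermost) y1,y2,u1,u2;
  C[y1,y2,u1,u2][y3] : complex poly poly poly poly poly, outer variable y3.\<close>

type_synonym cpoly2 = "complex poly poly"
type_synonym cpoly3 = "complex poly poly poly"
type_synonym cpolyYU = "complex poly poly poly poly"
type_synonym cpolyZ = "complex poly poly poly poly poly"

definition eval2 :: "cpoly2 \<Rightarrow> complex \<Rightarrow> complex \<Rightarrow> complex" where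
  "eval2 q a b = poly (poly q [:b:]) a"

definition eval3 :: "cpoly3 \<Rightarrow> complex \<Rightarrow> complex \<Rightarrow> complex \<Rightarrow> complex" where
  "eval3 F a b c = poly (poly (poly F [:[:c:]:]) [:b:]) a"

definition totdeg2 :: "cpoly2 \<Rightarrow> nat" where
  "totdeg2 q = Max ({0} \<union> {j + degree (coeff q j) | j. coeff q j \<noteq> 0})"

definition totdeg3 :: "cpoly3 \<Rightarrow> nat" where
  "totdeg3 F = Max ({0} \<union> {k + totdeg2 (coeff F k) | k. coeff F k \<noteq> 0})"

definition homog3 :: "nat \<Rightarrow> cpoly3 \<Rightarrow> bool" where
  "homog3 d F \<longleftrightarrow> (\<forall>k j i. coeff (coeff (coeff F k) j) i \<noteq> 0 \<longrightarrow> i + j + k = d)"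

definition homogenize :: "cpoly2 \<Rightarrow> cpoly3" where
  "homogenize f = (let d = totdeg2 f in
     (\<Sum>j\<le>d. \<Sum>i\<le>d. if i + j \<le> d
        then monom (monom (monom (coeff (coeff f j) i) i) j) (d - i - j) else 0))"

definition Zcoeff :: "cpolyZ \<Rightarrow> nat \<times> nat \<Rightarrow> cpoly3" where
  "Zcoeff Z \<alpha> = map_poly (\<lambda>c. coeff (coeff c (snd \<alpha>)) (fst \<alpha>)) Z"

definition evalu :: "complex \<times> complex \<Rightarrow> cpolyYU \<Rightarrow> cpoly2" where
  "evalu w c = poly (map_poly (\<lambda>q. poly q [:[:fst w:]:]) c) [:[:snd w:]:]"

definition Zspec :: "cpolyZ \<Rightarrow> complex \<times> complex \<Rightarrow> cpoly3" where
  "Zspec Z w = map_poly (evalu w) Z"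

definition degyH :: "cpolyZ \<Rightarrow> nat" where
  "degyH Z = Max ({0} \<union> {totdeg3 (Zcoeff Z \<alpha>) | \<alpha>. True})"

definition liftU :: "cpoly3 \<Rightarrow> cpolyZ" where
  "liftU G = map_poly (\<lambda>q. [:[:q:]:]) G"

definition content_u :: "cpolyYU \<Rightarrow> cpoly2" where
  "content_u h = Gcd {coeff (coeff h i) j | i j. True}"

definition PP_u :: "cpolyYU \<Rightarrow> cpolyYU" where
  "PP_u h = map_poly (map_poly (\<lambda>c. c div content_u h)) h"

definition degy12 :: "cpolyYU \<Rightarrow> nat" where
  "degy12 h = Max ({0} \<union> {totdeg2 (coeff (coeff h i) j) | i j. True})"

type_synonym cvec3 = "complex \<times> complex \<times> complex"

definition ppt :: "cvec3 \<Rightarrow> cvec3 set" where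
  "ppt v = {(t * fst v, t * fst (snd v), t * snd (snd v)) | t. t \<noteq> 0}"

definition pzeros :: "cpoly3 \<Rightarrow> cvec3 set set" where
  "pzeros F = {ppt (a,b,c) | a b c. (a,b,c) \<noteq> (0,0,0) \<and> eval3 F a b c = 0}"

definition zariski_open2 :: "(complex \<times> complex) set \<Rightarrow> bool" where
  "zariski_open2 U \<longleftrightarrow> (\<exists>S. U = - {(a,b). \<forall>p\<in>S. eval2 p a b = 0})"

text \<open>Affine intersection multiplicity I_P(F,G) = dim_C O_P / (F,G) O_P at P = (a,b),
  where O_P is the local ring of C^2 at P, elements of O_P being written n/d with d(P) \<noteq> 0.
  An element n/d lies in (F,G) O_P iff n/d = (rF+sG)/c with c(P) \<noteq> 0.\<close>
definition in_loc_ideal :: "cpoly2 \<Rightarrow> cpoly2 \<Rightarrow> complex \<times> complex \<Rightarrow> cpoly2 \<Rightarrow> cpoly2 \<Rightarrow> bool" where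
  "in_loc_ideal F G P n d \<longleftrightarrow>
     (\<exists>r s c. eval2 c (fst P) (snd P) \<noteq> 0 \<and> n * c = d * (r * F + s * G))"

text \<open>Elements n_i/d_i (i<k) of O_P are linearly independent modulo (F,G) O_P.\<close>
definition loc_indep :: "cpoly2 \<Rightarrow> cpoly2 \<Rightarrow> complex \<times> complex \<Rightarrow> nat \<Rightarrow>
    (nat \<Rightarrow> cpoly2) \<Rightarrow> (nat \<Rightarrow> cpoly2) \<Rightarrow> bool" where
  "loc_indep F G P k n d \<longleftrightarrow>
     (\<forall>i<k. eval2 (d i) (fst P) (snd P) \<noteq> 0) \<and>
     (\<forall>lam :: nat \<Rightarrow> complex. (\<exists>i<k. lam i \<noteq> 0) \<longrightarrow>
        \<not> in_loc_ideal F G P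
            (\<Sum>i<k. [:[:lam i:]:] * n i * (\<Prod>j\<in>{..<k} - {i}. d j))
            (\<Prod>j<k. d j))"

definition aff_mult :: "cpoly2 \<Rightarrow> cpoly2 \<Rightarrow> complex \<times> complex \<Rightarrow> enat" where
  "aff_mult F G P = Sup {enat k | k. \<exists>n d. loc_indep F G P k n d}"

definition chart_mult :: "cpoly3 \<Rightarrow> cpoly3 \<Rightarrow> cvec3 \<Rightarrow> enat" where
  "chart_mult F G v = (case v of (v1, v2, v3) \<Rightarrow>
     if v3 \<noteq> 0 then aff_mult (poly F 1) (poly G 1) (v1 / v3, v2 / v3)
     else if v2 \<noteq> 0 then aff_mult (map_poly (\<lambda>q. poly q 1) F) (map_poly (\<lambda>q. poly q 1) G)
                            (v1 / v2, v3 / v2)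
     else aff_mult (map_poly (map_poly (\<lambda>r. poly r 1)) F) (map_poly (map_poly (\<lambda>r. poly r 1)) G)
                   (v2 / v1, v3 / v1))"

definition pmult :: "cpoly3 \<Rightarrow> cpoly3 \<Rightarrow> cvec3 set \<Rightarrow> enat" where
  "pmult F G p = chart_mult F G (SOME v. v \<in> p)"

end

theory Submission
  imports Defs "Subresultants.Subresultant_Gcd" "HOL-Computational_Algebra.Fundamental_Theorem_Algebra"
begin

text \<open>
  Write \<open>R = Res(G, Z) = C P\<close> with content \<open>C\<close> and primitive part \<open>P\<close>, both homogeneous in
  \<open>y1, y2\<close>. For generic \<open>w\<close> no point \<open>(t : 1)\<close> with \<open>C(t, 1) lc(G)(t, 1) = 0\<close> lies under a non-fixed
  intersection point or is a root of \<open>P\<close> specialised at \<open>w\<close>, and likewise for \<open>(1 : 0)\<close>. Over every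
  other root \<open>t\<close> all intersection points are non-fixed, since a fixed one would make \<open>R\<close> vanish at
  \<open>(t, 1)\<close> for all parameters; hence they have multiplicity one, and their number is the order of the
  resultant at \<open>t\<close>, that is, the order of \<open>P\<close> at \<open>t\<close>. Summing over the roots gives the degree of \<open>P\<close>.

  The local statement follows by replacing rows of the Sylvester matrix: if \<open>g = d A\<close>, \<open>h = d B\<close> on the
  fibre, with \<open>d\<close> the gcd, then \<open>A h - B g = (y - t) E\<close>, and transversality says that \<open>d\<close> is
  squarefree and coprime to \<open>E\<close>. So \<open>deg d\<close> factors \<open>y - t\<close> split off and the remaining determinant
  does not vanish at \<open>t\<close>.
\<close>

subsection \<open>Graded rings\<close>

text \<open>\<open>A k\<close> is the predicate of having degree \<open>k\<close>. The pieces need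
  neither be independent nor span the ring, so filtrations by degree bounds are instances as well as
  gradings.\<close>

definition graded :: "(int \<Rightarrow> 'a::comm_ring_1 \<Rightarrow> bool) \<Rightarrow> bool" where
  "graded A \<longleftrightarrow> (\<forall>k. A k 0) \<and> A 0 1 \<and> (\<forall>k x y. A k x \<longrightarrow> A k y \<longrightarrow> A k (x + y)) \<and>
     (\<forall>k x. A k x \<longrightarrow> A k (- x)) \<and> (\<forall>k l x y. A k x \<longrightarrow> A l y \<longrightarrow> A (k + l) (x * y))"

text \<open>The adjoined variable gets weight \<open>w\<close>: below, \<open>1\<close> or
  \<open>-1\<close> for coordinates and \<open>0\<close> for parameters.\<close>

definition grade_poly :: "int \<Rightarrow> (int \<Rightarrow> 'a::comm_ring_1 \<Rightarrow> bool) \<Rightarrow> int \<Rightarrow> 'a poly \<Rightarrow> bool" where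
  "grade_poly w A k p \<longleftrightarrow> (\<forall>i. A (k - w * int i) (coeff p i))"

lemma gradedD:
  assumes "graded A"
  shows "A k 0" "A 0 1" "A k x \<Longrightarrow> A k y \<Longrightarrow> A k (x + y)" "A k x \<Longrightarrow> A k (- x)"
    "A k x \<Longrightarrow> A l y \<Longrightarrow> A (k + l) (x * y)"
  using assms unfolding graded_def by blast+

lemma graded_sum:
  assumes "graded A" "\<And>i. i \<in> S \<Longrightarrow> A k (f i)"
  shows "A k (sum f S)"
  using assms(2) by (induction S rule: infinite_finite_induct) (auto intro: gradedD[OF assms(1)])

lemma graded_prod:
  assumes "graded A" "\<And>i. i \<in> S \<Longrightarrow> A (d i) (f i)"
  shows "A (sum d S) (prod f S)"
  using assms(2) by (induction S rule: infinite_finite_induct) (auto intro: gradedD[OF assms(1)])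

lemma graded_grade_poly:
  assumes "graded A"
  shows "graded (grade_poly w A)"
proof -
  note * = gradedD[OF assms]
  have mul: "grade_poly w A (k + l) (x * y)" if "grade_poly w A k x" "grade_poly w A l y" for k l x y
    unfolding grade_poly_def
  proof
    fix i
    have "A (k + l - w * int i) (coeff x j * coeff y (i - j))" if "j \<le> i" for j
    proof -
      have "A ((k - w * int j) + (l - w * int (i - j))) (coeff x j * coeff y (i - j))"
        using \<open>grade_poly w A k x\<close> \<open>grade_poly w A l y\<close> by (intro *(5)) (auto simp: grade_poly_def)
      moreover have "(k - w * int j) + (l - w * int (i - j)) = k + l - w * int i"
        using that by (simp add: of_nat_diff algebra_simps)
      ultimately show ?thesis by simp
    qed
    then show "A (k + l - w * int i) (coeff (x * y) i)"
      unfolding coeff_mult by (intro graded_sum[OF assms]) auto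
  qed
  have one: "grade_poly w A 0 1"
    unfolding grade_poly_def by (auto intro: * simp: coeff_1)
  show ?thesis
    unfolding graded_def[of "grade_poly w A"] using mul one by (auto simp: grade_poly_def intro: *)
qed

text \<open>Each Leibniz product uses every row and every column once, so all of them have the same
  degree.\<close>

lemma graded_det:
  assumes "graded A" and M: "M \<in> carrier_mat n n"
    and e: "\<And>i j. i < n \<Longrightarrow> j < n \<Longrightarrow> A (r i + c j) (M $$ (i, j))"
  shows "A (sum r {0..<n} + sum c {0..<n}) (det M)"
proof -
  note * = gradedD[OF assms(1)]
  have "A (sum r {0..<n} + sum c {0..<n}) (signof p * (\<Prod>i = 0..<n. M $$ (i, p i)))"
    if p: "p permutes {0..<n}" for p
  proof -
    have "A (\<Sum>i = 0..<n. r i + c (p i)) (\<Prod>i = 0..<n. M $$ (i, p i))"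
      using p by (intro graded_prod[OF assms(1)] e) (auto simp: permutes_in_image[OF p])
    also have "(\<Sum>i = 0..<n. r i + c (p i)) = sum r {0..<n} + sum c {0..<n}"
      using sum.permute[OF p, of c] by (simp add: sum.distrib comp_def)
    finally have "A (sum r {0..<n} + sum c {0..<n}) (\<Prod>i = 0..<n. M $$ (i, p i))" .
    then show ?thesis using *(4) by (cases p rule: sign_cases) auto
  qed
  then show ?thesis
    unfolding det_def'[OF M] by (intro graded_sum[OF assms(1)]) auto
qed

text \<open>One step to the right in the Sylvester matrix lowers the coefficient index by one and so
  raises the degree by \<open>w\<close>. Hence the degree of an entry splits into a row part and the
  column part \<open>w * j\<close>.\<close>

lemma graded_resultant:
  assumes A: "graded A" and "grade_poly w A a p" "grade_poly w A b q"
  shows "\<exists>M. A M (resultant p q)"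
proof -
  let ?m = "degree p" and ?e = "degree q"
  \<comment> \<open>\<open>r i\<close> is the degree belonging to column \<open>0\<close>, where the
    formal coefficient index is \<open>?m + i\<close> in a row of \<open>p\<close> and
    \<open>i\<close> in a row of \<open>q\<close>.\<close>
  define r where "r i = (if i < ?e then a - w * (int ?m + int i) else b - w * int i)" for i
  have "A (r i + w * int j) (sylvester_mat p q $$ (i, j))" if "i < ?m + ?e" "j < ?m + ?e" for i j
  proof -
    have 1: "A (r i + w * int j) (coeff p (?m + i - j))" if "i < ?e" "i \<le> j" "j - i \<le> ?m"
    proof -
      have "r i + w * int j = a - w * int (?m + i - j)"
        using that by (simp add: r_def of_nat_diff algebra_simps)
      then show ?thesis using assms(2) by (simp add: grade_poly_def)
    qed
    have 2: "A (r i + w * int j) (coeff q (i - j))" if "\<not> i < ?e" "j \<le> i"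
    proof -
      have "r i + w * int j = b - w * int (i - j)"
        using that by (simp add: r_def of_nat_diff algebra_simps)
      then show ?thesis using assms(3) by (simp add: grade_poly_def)
    qed
    show ?thesis
      using 1 2 gradedD(1)[OF A] by (auto simp: sylvester_index_mat that)
  qed
  from graded_det[OF A sylvester_carrier_mat this] show ?thesis unfolding resultant_def by blast
qed

subsection \<open>Homogeneous polynomials in two variables\<close>

text \<open>With \<open>w = 1\<close>, resp. \<open>w = -1\<close>, the exponent \<open>k\<close> in \<open>bounded_deg w k\<close> is an upper bound of the
  total degrees, resp. minus a lower bound.\<close>

definition homog2 :: "int \<Rightarrow> int \<Rightarrow> cpoly2 \<Rightarrow> bool" where
  "homog2 w = grade_poly w (grade_poly w (\<lambda>k c. c \<noteq> 0 \<longrightarrow> k = 0))"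

definition bounded_deg :: "int \<Rightarrow> int \<Rightarrow> cpoly2 \<Rightarrow> bool" where
  "bounded_deg w = grade_poly w (grade_poly w (\<lambda>k c. c \<noteq> 0 \<longrightarrow> 0 \<le> k))"

lemma graded_homog2: "graded (homog2 w)"
  unfolding homog2_def by (intro graded_grade_poly) (auto simp: graded_def)

lemma graded_bounded_deg: "graded (bounded_deg w)"
  unfolding bounded_deg_def
  by (intro graded_grade_poly) (auto simp: graded_def add_eq_0_iff)

lemma homog2_iff: "homog2 w k q \<longleftrightarrow> (\<forall>j i. coeff (coeff q j) i \<noteq> 0 \<longrightarrow> w * (int i + int j) = k)"
  by (simp add: homog2_def grade_poly_def algebra_simps) (metis add.commute)

lemma bounded_deg_iff:
  "bounded_deg w k q \<longleftrightarrow> (\<forall>j i. coeff (coeff q j) i \<noteq> 0 \<longrightarrow> w * (int i + int j) \<le> k)"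
  by (simp add: bounded_deg_def grade_poly_def algebra_simps)

lemma homog2_imp_bounded_deg: "homog2 w k q \<Longrightarrow> bounded_deg w k q"
  by (simp add: homog2_iff bounded_deg_iff)

lemma bounded_deg_mono: "bounded_deg w k q \<Longrightarrow> k \<le> l \<Longrightarrow> bounded_deg w l q"
  unfolding bounded_deg_iff by force

lemma exists_poly_coeffs:
  fixes c :: "nat \<Rightarrow> 'a::comm_monoid_add"
  assumes "\<And>i. n < i \<Longrightarrow> c i = 0"
  shows "\<exists>r. \<forall>i. coeff r i = c i"
proof -
  have "coeff (\<Sum>i\<le>n. monom (c i) i) k = c k" for k
    using assms[of k] by (cases "k \<le> n") (auto simp: coeff_sum)
  then show ?thesis by blast
qed

lemma exists_poly2_restrict:
  fixes q :: "'a::comm_ring_1 poly poly"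
  shows "\<exists>r. \<forall>j i. coeff (coeff r j) i = (if P j i then coeff (coeff q j) i else 0)"
proof -
  have "\<exists>s. \<forall>i. coeff s i = (if P j i then coeff (coeff q j) i else 0)" for j
    by (rule exists_poly_coeffs[of "degree (coeff q j)"]) (simp add: coeff_eq_0)
  then obtain s where s: "\<And>j i. coeff (s j) i = (if P j i then coeff (coeff q j) i else 0)"
    by metis
  have "\<exists>r. \<forall>j. coeff r j = s j"
    by (rule exists_poly_coeffs[of "degree q"]) (auto simp: poly_eq_iff s coeff_eq_0)
  then show ?thesis using s by metis
qed

text \<open>For \<open>w = 1\<close> the part \<open>q1\<close> is the form of highest degree in
  \<open>q\<close>, for \<open>w = -1\<close> the form of lowest degree.\<close>

lemma top_component:
  assumes "q \<noteq> 0"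
  obtains k q1 q2 where "q = q1 + q2" "homog2 w k q1" "q1 \<noteq> 0" "bounded_deg w (k - 1) q2"
proof -
  define S where "S = {(j, i). coeff (coeff q j) i \<noteq> 0}"
  have "S \<subseteq> (SIGMA j:{..degree q}. {..degree (coeff q j)})"
  proof
    fix x assume "x \<in> S"
    then have "coeff (coeff q (fst x)) (snd x) \<noteq> 0" by (auto simp: S_def)
    moreover from this have "coeff q (fst x) \<noteq> 0" by auto
    ultimately show "x \<in> (SIGMA j:{..degree q}. {..degree (coeff q j)})"
      by (cases x) (auto intro: le_degree)
  qed
  then have fin: "finite S" by (rule finite_subset) auto
  obtain j0 i0 where "coeff (coeff q j0) i0 \<noteq> 0"
    using assms by (metis coeff_0 leading_coeff_neq_0)
  then have ne: "S \<noteq> {}" by (auto simp: S_def)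
  define d where "d = (\<lambda>(j, i). w * (int i + int j))"
  define k where "k = Max (d ` S)"
  have kin: "k \<in> d ` S" unfolding k_def using fin ne by (intro Max_in) auto
  have kmax: "d x \<le> k" if "x \<in> S" for x unfolding k_def using fin that by auto
  obtain q1 where q1: "\<And>j i. coeff (coeff q1 j) i = (if d (j, i) = k then coeff (coeff q j) i else 0)"
    using exists_poly2_restrict[of "\<lambda>j i. d (j, i) = k" q] by blast
  obtain ja ia where "(ja, ia) \<in> S" "d (ja, ia) = k" using kin by auto
  then have "coeff (coeff q1 ja) ia \<noteq> 0" by (auto simp: q1 S_def)
  then have "q1 \<noteq> 0" by auto
  moreover have "homog2 w k q1"
    unfolding homog2_iff q1 by (auto simp: d_def)
  moreover have "bounded_deg w (k - 1) (q - q1)"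
    unfolding bounded_deg_iff
  proof (intro allI impI)
    fix j i assume "coeff (coeff (q - q1) j) i \<noteq> 0"
    then have "coeff (coeff q j) i \<noteq> 0" "d (j, i) \<noteq> k" by (auto simp: q1 split: if_splits)
    with kmax[of "(j, i)"] show "w * (int i + int j) \<le> k - 1" by (auto simp: S_def d_def)
  qed
  ultimately show ?thesis using that[of q1 "q - q1" k] by simp
qed

lemma exists_coeff2_nonzero: "q \<noteq> 0 \<Longrightarrow> \<exists>j i. coeff (coeff q j) i \<noteq> (0::complex)"
  by (metis coeff_0 leading_coeff_neq_0)

text \<open>The top forms have a nonzero product because the ring is a domain, and no other part of
  \<open>p * q\<close> reaches its degree \<open>k + l\<close>.\<close>

lemma homog2_mult_bounds:
  assumes "homog2 w M (p * q)" "p \<noteq> 0" "q \<noteq> 0"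
  shows "\<exists>k l. bounded_deg w k p \<and> bounded_deg w l q \<and> k + l = M"
proof -
  obtain k p1 p2 where p: "p = p1 + p2" "homog2 w k p1" "p1 \<noteq> 0" "bounded_deg w (k - 1) p2"
    using top_component[OF assms(2)] by blast
  obtain l q1 q2 where q: "q = q1 + q2" "homog2 w l q1" "q1 \<noteq> 0" "bounded_deg w (l - 1) q2"
    using top_component[OF assms(3)] by blast
  note gH = gradedD[OF graded_homog2[of w]] and gU = gradedD[OF graded_bounded_deg[of w]]
  have Up: "bounded_deg w k p" unfolding p(1)
    using homog2_imp_bounded_deg[OF p(2)] bounded_deg_mono[OF p(4)] by (intro gU(3)) auto
  have Uq: "bounded_deg w l q" unfolding q(1)
    using homog2_imp_bounded_deg[OF q(2)] bounded_deg_mono[OF q(4)] by (intro gU(3)) auto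
  have "p1 * q1 \<noteq> 0" using p q by simp
  then obtain j i where ji: "coeff (coeff (p1 * q1) j) i \<noteq> 0" using exists_coeff2_nonzero by blast
  with gH(5)[OF p(2) q(2)] have d: "w * (int i + int j) = k + l" unfolding homog2_iff by blast
  have "bounded_deg w (k + l - 1) (p2 * q + p1 * q2)"
  proof (rule gU(3))
    show "bounded_deg w (k + l - 1) (p2 * q)" using gU(5)[OF p(4) Uq] by (simp add: algebra_simps)
    show "bounded_deg w (k + l - 1) (p1 * q2)"
      using gU(5)[OF homog2_imp_bounded_deg[OF p(2)] q(4)] by (simp add: algebra_simps)
  qed
  with d have "coeff (coeff (p2 * q + p1 * q2) j) i = 0" unfolding bounded_deg_iff by force
  moreover have "p * q = p1 * q1 + (p2 * q + p1 * q2)" by (simp add: p(1) q(1) algebra_simps)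
  ultimately have "coeff (coeff (p * q) j) i \<noteq> 0" using ji by simp
  with assms(1) d have "k + l = M" unfolding homog2_iff by metis
  with Up Uq show ?thesis by blast
qed

text \<open>With \<open>w = 1\<close> and \<open>w = -1\<close> the bounds concern the highest and
  the lowest degrees of the factors. Both pairs add up to \<open>M\<close>, and lowest is at most
  highest in each factor, so they agree.\<close>

lemma homog2_factor:
  assumes "homog2 1 M (p * q)" "p * q \<noteq> 0"
  shows "\<exists>k. homog2 1 k p"
proof -
  have nz: "p \<noteq> 0" "q \<noteq> 0" using assms(2) by auto
  have "homog2 (-1) (-M) (p * q)" using assms(1) unfolding homog2_iff by force
  from homog2_mult_bounds[OF this nz] obtain k' l' where
    k': "bounded_deg (-1) k' p" "bounded_deg (-1) l' q" "k' + l' = -M" by blast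
  from homog2_mult_bounds[OF assms(1) nz] obtain k l where
    k: "bounded_deg 1 k p" "bounded_deg 1 l q" "k + l = M" by blast
  obtain j i where "coeff (coeff p j) i \<noteq> 0" using exists_coeff2_nonzero nz by blast
  with k k' have 1: "-k' \<le> k" unfolding bounded_deg_iff by force
  obtain j i where "coeff (coeff q j) i \<noteq> 0" using exists_coeff2_nonzero nz by blast
  with k k' have "-l' \<le> l" unfolding bounded_deg_iff by force
  with 1 k k' have "-k' = k" by linarith
  then have "homog2 1 k p" using k(1) k'(1) unfolding homog2_iff bounded_deg_iff by force
  then show ?thesis by blast
qed

subsection \<open>Evaluation\<close>

lemma map_poly_pCons_0: "f 0 = 0 \<Longrightarrow> map_poly f (pCons c p) = pCons (f c) (map_poly f p)"
  by (rule poly_eqI) (simp add: coeff_map_poly coeff_pCons split: nat.split)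

lemma eval2_add [simp]: "eval2 (p + q) a b = eval2 p a b + eval2 q a b"
  and eval2_diff [simp]: "eval2 (p - q) a b = eval2 p a b - eval2 q a b"
  and eval2_minus [simp]: "eval2 (- p) a b = - eval2 p a b"
  and eval2_mult [simp]: "eval2 (p * q) a b = eval2 p a b * eval2 q a b"
  and eval2_0 [simp]: "eval2 0 a b = 0"
  and eval2_1 [simp]: "eval2 1 a b = 1"
  and eval2_pCons: "eval2 (pCons r p) a b = poly r a + b * eval2 p a b"
  by (simp_all add: eval2_def)

lemma eval2_smult [simp]: "eval2 (smult r p) a b = poly r a * eval2 p a b"
  by (simp add: eval2_def)

lemma eval2_sum: "eval2 (sum f S) a b = (\<Sum>i\<in>S. eval2 (f i) a b)"
  by (induction S rule: infinite_finite_induct) auto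

lemma eval2_prod: "eval2 (prod f S) a b = (\<Prod>i\<in>S. eval2 (f i) a b)"
  by (induction S rule: infinite_finite_induct) auto

lemma comm_ring_hom_eval2: "comm_ring_hom (\<lambda>q. eval2 q a b)"
  by unfold_locales auto

lemma eval2_altdef:
  "eval2 q a b = (\<Sum>j\<le>degree q. \<Sum>i\<le>degree (coeff q j). coeff (coeff q j) i * a ^ i * b ^ j)"
proof -
  have "eval2 q a b = (\<Sum>j\<le>degree q. poly (coeff q j) a * b ^ j)"
    by (simp add: eval2_def poly_altdef[of q] poly_sum poly_power)
  then show ?thesis by (simp add: poly_altdef[of "coeff q _"] sum_distrib_right)
qed

lemma eval2_homog2_scale:
  assumes "homog2 1 N q"
  shows "eval2 q (s * a) (s * b) = s ^ nat N * eval2 q a b"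
proof -
  have "coeff (coeff q j) i * (s * a) ^ i * (s * b) ^ j =
      s ^ nat N * (coeff (coeff q j) i * a ^ i * b ^ j)" for i j
  proof (cases "coeff (coeff q j) i = 0")
    case False
    with assms have "nat N = i + j" unfolding homog2_iff by fastforce
    then show ?thesis by (simp add: power_mult_distrib power_add)
  qed simp
  then show ?thesis by (simp only: eval2_altdef sum_distrib_left)
qed

lemma eval3_conv_eval2: "eval3 F a b c = poly (map_poly (\<lambda>q. eval2 q a b) F) c"
  unfolding eval3_def by (induction F) (auto simp: map_poly_pCons_0 eval2_def)

lemma eval3_altdef: "eval3 F a b c = (\<Sum>k\<le>degree F. eval2 (coeff F k) a b * c ^ k)"
proof -
  have "eval3 F a b c = eval2 (poly F [:[:c:]:]) a b" by (simp add: eval3_def eval2_def)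
  also have "\<dots> = (\<Sum>k\<le>degree F. eval2 (coeff F k) a b * c ^ k)"
    unfolding poly_altdef[of F] eval2_sum
    by (simp add: eval2_def poly_power)
  finally show ?thesis .
qed

lemma homog2_coeff_homog3: "homog3 d F \<Longrightarrow> homog2 1 (int d - int k) (coeff F k)"
  unfolding homog3_def homog2_iff by force

lemma homog3_coeff_eq_0: "homog3 d F \<Longrightarrow> d < k \<Longrightarrow> coeff F k = 0"
  unfolding homog3_def poly_eq_iff by fastforce

lemma eval3_homog3_scale:
  assumes "homog3 d F"
  shows "eval3 F (s * a) (s * b) (s * c) = s ^ d * eval3 F a b c"
proof -
  have "eval2 (coeff F k) (s * a) (s * b) * (s * c) ^ k = s ^ d * (eval2 (coeff F k) a b * c ^ k)" for k
  proof (cases "k \<le> d")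
    case True
    then have "nat (int d - int k) + k = d" by simp
    then show ?thesis
      using eval2_homog2_scale[OF homog2_coeff_homog3[OF assms, of k]]
      by (simp add: power_mult_distrib flip: power_add)
  qed (simp add: homog3_coeff_eq_0[OF assms])
  then show ?thesis by (simp only: eval3_altdef sum_distrib_left)
qed

lemma eval2_poly_1: "eval2 (poly F 1) a b = eval3 F a b 1"
  by (simp add: eval2_def eval3_def flip: one_pCons)

lemma eval2_map_poly_1: "eval2 (map_poly (\<lambda>q. poly q 1) F) a c = eval3 F a 1 c"
proof -
  have "eval2 (map_poly (\<lambda>q. poly q 1) F) a c = poly (map_poly (\<lambda>q. eval2 q a 1) F) c"
    by (induction F) (simp_all add: map_poly_pCons_0 eval2_pCons eval2_def flip: one_pCons)
  then show ?thesis by (simp add: eval3_conv_eval2)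
qed

text \<open>A nonzero \<open>q\<close> has finitely many roots in the domain \<open>C[y1]\<close>,
  whereas here all constants would be roots.\<close>

lemma eval2_eq_0_imp_eq_0:
  assumes "\<And>a b. eval2 q a b = 0"
  shows "q = 0"
proof (rule ccontr)
  assume "q \<noteq> 0"
  then have "finite {x. poly q x = 0}" by (rule poly_roots_finite)
  then have "finite ((\<lambda>b::complex. [:b:]) -` {x. poly q x = 0})" by (rule finite_vimageI) (auto intro: injI)
  moreover have "(\<lambda>b::complex. [:b:]) -` {x. poly q x = 0} = UNIV"
  proof -
    have "poly q [:b:] = 0" for b
      using assms unfolding eval2_def by (simp add: poly_all_0_iff_0[symmetric])
    then show ?thesis by auto
  qed
  ultimately show False using infinite_UNIV_char_0 by metis
qed

text \<open>The divisor is \<open>b y1 - a y2\<close>, the equation of the line spanned by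
  \<open>(a, b)\<close>. For \<open>a \<noteq> 0\<close> this is the factor theorem in
  \<open>y2\<close> at the root \<open>(b / a) y1\<close>; for \<open>a = 0\<close> all coefficients
  vanish at \<open>y1 = 0\<close>.\<close>

lemma line_form_dvd:
  assumes zero: "\<And>s. eval2 q (s * a) (s * b) = 0" and ab: "a \<noteq> 0 \<or> b \<noteq> 0"
  shows "[:[:0, b:], [:- a:]:] dvd q"
proof (cases "a = 0")
  case False
  define r where "r = b / a"
  have "poly (poly q p) s = eval2 q s (poly p s)" for p s
    by (induction q) (auto simp: eval2_pCons)
  then have "poly (poly q [:0, r:]) s = 0" for s
    using zero[of "s / a"] False by (simp add: r_def field_simps)
  then have "poly q [:0, r:] = 0" by (simp add: poly_all_0_iff_0[symmetric])
  then have "[:- [:0, r:], 1:] dvd q" by (simp add: poly_eq_0_iff_dvd)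
  then obtain q' where q': "q = [:- [:0, r:], 1:] * q'" by blast
  \<comment> \<open>Scaling by the unit \<open>- a\<close> turns \<open>y2 - r y1\<close> into
    \<open>b y1 - a y2\<close>.\<close>
  have "smult [:- a:] p * smult [:- 1 / a:] p' = p * p'" for p p' :: cpoly2
    using False by (simp add: mult.commute flip: one_pCons)
  then have "smult [:- a:] [:- [:0, r:], 1:] dvd q" unfolding q' by (metis dvd_triv_left)
  moreover have "smult [:- a:] [:- [:0, r:], 1:] = [:[:0, b:], [:- a:]:]"
    using False by (simp add: r_def)
  ultimately show ?thesis by simp
next
  case True
  then have b: "b \<noteq> 0" using ab by simp
  have "poly (map_poly (\<lambda>p. poly p 0) q) c = eval2 q 0 c" for c
    by (induction q) (auto simp: eval2_pCons map_poly_pCons_0)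
  then have "poly (map_poly (\<lambda>p. poly p 0) q) c = 0" for c
    using zero[of "c / b"] True b by simp
  then have "map_poly (\<lambda>p. poly p 0) q = 0" by (simp add: poly_all_0_iff_0[symmetric])
  then have "poly (coeff q i) 0 = 0" for i by (metis coeff_0 coeff_map_poly poly_0)
  then have "[:0, 1:] dvd coeff q i" for i using poly_eq_0_iff_dvd[of "coeff q i" 0] by simp
  then have "[:0, b:] dvd coeff q i" for i using b
    by (metis mult.right_neutral mult_zero_right smult_dvd_iff smult_0_right smult_pCons)
  then have "[:[:0, b:]:] dvd q" by (simp add: const_poly_dvd_iff)
  then show ?thesis using True by simp
qed

subsection \<open>Specialisation of the parameters\<close>

text \<open>Dual to \<open>evalu\<close>: the coordinates are fixed and the result is a polynomial
  in the parameters, \<open>u1\<close> being the inner variable.\<close>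

definition eval_coords :: "complex \<Rightarrow> complex \<Rightarrow> cpolyYU \<Rightarrow> cpoly2" where
  "eval_coords a b = map_poly (map_poly (\<lambda>q. eval2 q a b))"

lemma coeff_eval_coords [simp]: "coeff (coeff (eval_coords a b x) i) j = eval2 (coeff (coeff x i) j) a b"
  by (simp add: eval_coords_def coeff_map_poly)

lemma eval2_evalu: "eval2 (evalu w x) a b = eval2 (eval_coords a b x) (fst w) (snd w)"
proof -
  have inner: "eval2 (poly q [:[:u:]:]) a b = poly (map_poly (\<lambda>r. eval2 r a b) q) u" for q u
    by (induction q) (auto simp: map_poly_pCons_0 eval2_pCons)
  show ?thesis
    unfolding evalu_def eval_coords_def
    by (induction x) (auto simp: map_poly_pCons_0 eval2_pCons inner)
qed

lemma comm_ring_hom_evalu: "comm_ring_hom (evalu w)"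
proof -
  interpret h1: comm_ring_hom "\<lambda>q::complex poly poly poly. poly q [:[:fst w:]:]" by unfold_locales auto
  interpret h1p: map_poly_comm_ring_hom "\<lambda>q::complex poly poly poly. poly q [:[:fst w:]:]" ..
  show ?thesis
    by unfold_locales (simp_all add: evalu_def h1p.hom_add h1p.hom_mult)
qed

lemma comm_ring_hom_eval_coords: "comm_ring_hom (eval_coords a b)"
proof -
  interpret h1: comm_ring_hom "\<lambda>q. eval2 q a b" by (rule comm_ring_hom_eval2)
  interpret h1p: map_poly_comm_ring_hom "\<lambda>q. eval2 q a b" ..
  interpret h2p: map_poly_comm_ring_hom "map_poly (\<lambda>q. eval2 q a b)" ..
  show ?thesis
    unfolding eval_coords_def by unfold_locales (simp_all add: h2p.hom_add h2p.hom_mult)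
qed

lemma homog2_evalu:
  assumes "\<And>i j. homog2 1 N (coeff (coeff x i) j)"
  shows "homog2 1 N (evalu w x)"
proof -
  note g = gradedD[OF graded_homog2]
  have const: "homog2 1 0 [:[:c:]:]" for c
    by (auto simp: homog2_iff coeff_pCons split: nat.splits)
  have inner: "homog2 1 N (poly q [:[:u:]:])" if "\<And>j. homog2 1 N (coeff q j)" for q u
    using that
  proof (induction q)
    case 0 then show ?case using g(1) by simp
  next
    case (pCons r q)
    have "homog2 1 N r" using pCons.prems[of 0] by simp
    moreover have "homog2 1 N (poly q [:[:u:]:])"
      using pCons.prems[of "Suc _"] by (intro pCons.IH) simp
    from g(5)[OF const this] have "homog2 1 N ([:[:u:]:] * poly q [:[:u:]:])" by simp
    ultimately show ?case using g(3) by simp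
  qed
  show ?thesis using assms
  proof (induction x)
    case 0 then show ?case using g(1) by (simp add: evalu_def)
  next
    case (pCons r x)
    have "homog2 1 N (poly r [:[:fst w:]:])" using pCons.prems[of 0] by (intro inner) simp
    moreover have "homog2 1 N (evalu w x)"
      using pCons.prems[of "Suc _"] by (intro pCons.IH) simp
    from g(5)[OF const this] have "homog2 1 N ([:[:snd w:]:] * evalu w x)" by simp
    ultimately show ?case using g(3) by (simp add: evalu_def map_poly_pCons_0)
  qed
qed

text \<open>The condition that a given point imposes on the parameters: it vanishes at those
  \<open>w\<close> whose curve passes through the point, and its coefficients are the values of the
  \<open>Zcoeff\<close> there.\<close>

definition eval_point :: "cpolyZ \<Rightarrow> complex \<Rightarrow> complex \<Rightarrow> complex \<Rightarrow> cpoly2" where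
  "eval_point Z a b c = poly (map_poly (eval_coords a b) Z) [:[:c:]:]"

lemma eval2_eval_point: "eval2 (eval_point Z a b c) (fst w) (snd w) = eval3 (Zspec Z w) a b c"
proof -
  interpret comm_ring_hom "evalu w" by (rule comm_ring_hom_evalu)
  interpret ec: comm_ring_hom "eval_coords a b" by (rule comm_ring_hom_eval_coords)
  show ?thesis
    unfolding eval_point_def eval3_conv_eval2 Zspec_def
    by (induction Z) (simp_all add: map_poly_pCons_0 eval2_pCons eval2_evalu)
qed

lemma coeff_eval_point: "coeff (coeff (eval_point Z a b c) j) i = eval3 (Zcoeff Z (i, j)) a b c"
proof -
  interpret ec: comm_ring_hom "eval_coords a b" by (rule comm_ring_hom_eval_coords)
  show ?thesis
    unfolding eval_point_def eval3_conv_eval2 Zcoeff_def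
    by (induction Z) (simp_all add: map_poly_pCons_0)
qed

subsection \<open>The order of a resultant at a transversal fibre\<close>

text \<open>Matrices are given by polynomials as rows, highest power first as in the Sylvester
  matrix, so that row operations become polynomial identities.\<close>

definition rows_mat :: "nat \<Rightarrow> (nat \<Rightarrow> 'a::comm_ring_1 poly) \<Rightarrow> 'a mat" where
  "rows_mat n r = mat n n (\<lambda>(i, j). coeff (r i) (n - 1 - j))"

lemma rows_mat_carrier [simp]: "rows_mat n r \<in> carrier_mat n n"
  by (simp add: rows_mat_def)

definition sylvester_row :: "'a::comm_ring_1 poly \<Rightarrow> 'a poly \<Rightarrow> nat \<Rightarrow> 'a poly" where
  "sylvester_row p q i = (if i < degree q then monom 1 (degree q - 1 - i) * p
     else monom 1 (degree p + degree q - 1 - i) * q)"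

lemma sylvester_mat_eq_rows:
  "sylvester_mat p q = rows_mat (degree p + degree q) (sylvester_row p q)"
proof (rule eq_matI)
  fix i j assume "i < dim_row (rows_mat (degree p + degree q) (sylvester_row p q))"
    "j < dim_col (rows_mat (degree p + degree q) (sylvester_row p q))"
  then have ij: "i < degree p + degree q" "j < degree p + degree q"
    by (auto simp: rows_mat_def)
  show "sylvester_mat p q $$ (i, j) = rows_mat (degree p + degree q) (sylvester_row p q) $$ (i, j)"
  proof -
    have shift: "coeff (monom 1 (Suc a) * r) (Suc b) = coeff (monom 1 a * r) b" for a b and r :: "'a poly"
      by (simp add: coeff_monom_mult)
    have "degree p + degree q - j = Suc (degree p + degree q - 1 - j)" using ij by simp
    moreover have "degree q - i = Suc (degree q - 1 - i)" if "i < degree q" using that by simp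
    moreover have "degree p + degree q - i = Suc (degree p + degree q - 1 - i)" using ij by simp
    ultimately show ?thesis
      using ij shift by (simp add: sylvester_index_mat2 rows_mat_def sylvester_row_def)
  qed
qed (auto simp: rows_mat_def)

lemma mult_rows_mat:
  fixes r :: "nat \<Rightarrow> 'a::comm_ring_1 poly"
  assumes "Q \<in> carrier_mat n n"
  shows "Q * rows_mat n r = rows_mat n (\<lambda>i. \<Sum>l<n. smult (Q $$ (i, l)) (r l))"
  using assms
  by (intro eq_matI) (auto simp: rows_mat_def scalar_prod_def coeff_sum atLeast0LessThan)

text \<open>By the degree bound no coefficient is cut off, so a kernel vector of the transpose is a
  linear relation between the polynomials.\<close>

lemma det_rows_mat_nonzero:
  fixes r :: "nat \<Rightarrow> 'a::field poly"
  assumes deg: "\<And>i. i < n \<Longrightarrow> r i = 0 \<or> degree (r i) < n"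
    and indep: "\<And>v. (\<Sum>i<n. smult (v i) (r i)) = 0 \<Longrightarrow> \<forall>i<n. v i = 0"
  shows "det (rows_mat n r) \<noteq> 0"
proof
  assume "det (rows_mat n r) = 0"
  then have "det (transpose_mat (rows_mat n r)) = 0"
    by (simp add: det_transpose[of _ n])
  then obtain v where v: "v \<in> carrier_vec n" "v \<noteq> 0\<^sub>v n"
    "transpose_mat (rows_mat n r) *\<^sub>v v = 0\<^sub>v n"
    using det_0_iff_vec_prod_zero[of "transpose_mat (rows_mat n r)" n] by auto
  have "coeff (\<Sum>i<n. smult (v $ i) (r i)) k = 0" for k
  proof (cases "k < n")
    case True
    have "(transpose_mat (rows_mat n r) *\<^sub>v v) $ (n - 1 - k) = 0"
      using True by (simp add: v(3))
    then have "(\<Sum>i<n. coeff (r i) k * v $ i) = 0"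
      using True v(1) by (simp add: scalar_prod_def rows_mat_def atLeast0LessThan)
    then show ?thesis by (simp add: coeff_sum mult.commute)
  next
    case False
    then have "coeff (r i) k = 0" if "i < n" for i
      using deg[OF that] by (auto intro: coeff_eq_0)
    then show ?thesis by (simp add: coeff_sum)
  qed
  then have "(\<Sum>i<n. smult (v $ i) (r i)) = 0" by (simp add: poly_eq_iff)
  from indep[OF this] v(1,2) show False by (auto intro: eq_vecI)
qed

lemma det_rows_mat_smult:
  "det (rows_mat n (\<lambda>i. smult (c i) (r i))) = (\<Prod>i<n. c i) * det (rows_mat n r)"
proof -
  have "det (rows_mat n (\<lambda>i. smult (c i) (r i))) =
      (\<Sum>p | p permutes {0..<n}. prod c {..<n} * (signof p * (\<Prod>i = 0..<n. rows_mat n r $$ (i, p i))))"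
    unfolding det_def'[OF rows_mat_carrier]
  proof (intro sum.cong refl)
    fix p assume "p \<in> {p. p permutes {0..<n}}"
    then have p: "p i < n" if "i < n" for i using that permutes_in_image[of p "{0..<n}" i] by auto
    have "(\<Prod>i = 0..<n. rows_mat n (\<lambda>i. smult (c i) (r i)) $$ (i, p i)) =
        (\<Prod>i = 0..<n. c i * rows_mat n r $$ (i, p i))"
      using p by (intro prod.cong) (auto simp: rows_mat_def)
    then show "signof p * (\<Prod>i = 0..<n. rows_mat n (\<lambda>i. smult (c i) (r i)) $$ (i, p i)) =
        prod c {..<n} * (signof p * (\<Prod>i = 0..<n. rows_mat n r $$ (i, p i)))"
      by (simp add: prod.distrib atLeast0LessThan ac_simps)
  qed
  then show ?thesis by (simp add: det_def'[OF rows_mat_carrier, of n r] sum_distrib_left)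
qed

lemma degree_eq_sum_order:
  fixes p :: "complex poly"
  assumes "p \<noteq> 0"
  shows "degree p = (\<Sum>z | poly p z = 0. order z p)"
proof -
  have "degree p = degree (smult (lead_coeff p) (\<Prod>z|poly p z = 0. [:-z, 1:] ^ order z p))"
    by (simp only: complex_poly_decompose)
  also have "\<dots> = (\<Sum>z | poly p z = 0. order z p)"
    using assms by (simp add: degree_prod_eq_sum_degree degree_power_eq)
  finally show ?thesis .
qed

lemma rsquarefree_card_roots:
  fixes p :: "complex poly"
  assumes "p \<noteq> 0" "\<And>z. poly p z = 0 \<Longrightarrow> poly (pderiv p) z \<noteq> 0"
  shows "card {z. poly p z = 0} = degree p"
proof -
  have "rsquarefree p" using assms(2) by (auto simp: rsquarefree_roots)
  then have "order z p = 1" if "poly p z = 0" for z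
    using that assms(1) order_root[of p z] unfolding rsquarefree_def by force
  then show ?thesis using degree_eq_sum_order[OF assms(1)] by simp
qed

lemma coprime_complex_polyI:
  fixes p q :: "complex poly"
  assumes "p \<noteq> 0" "\<And>z. poly p z = 0 \<Longrightarrow> poly q z \<noteq> 0"
  shows "coprime p q"
proof -
  have "degree (gcd p q) = 0"
  proof (rule ccontr)
    assume "degree (gcd p q) \<noteq> 0"
    then obtain z where "poly (gcd p q) z = 0"
      using fundamental_theorem_of_algebra constant_degree by metis
    then have "poly p z = 0" "poly q z = 0"
      by (metis dvd_trans gcd_dvd1 gcd_dvd2 poly_eq_0_iff_dvd)+
    then show False using assms by blast
  qed
  then have "is_unit (gcd p q)" using assms(1) by (simp add: is_unit_iff_degree)
  then show ?thesis by (intro coprimeI) (rule dvd_trans, rule gcd_greatest)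
qed

lemma eval2_alt: "eval2 g t z = poly (map_poly (\<lambda>p. poly p t) g) z"
  unfolding eval2_def by (induction g) (auto simp: map_poly_pCons)

text \<open>\<open>map_poly pderiv\<close> is the partial derivative in the inner variable,
  \<open>pderiv\<close> that in the outer one.\<close>

lemma map_poly_pderiv_mult:
  fixes p q :: "'a::idom poly poly"
  shows "map_poly pderiv (p * q) = map_poly pderiv p * q + p * map_poly pderiv q"
  by (rule poly_eqI)
    (simp add: coeff_map_poly coeff_mult pderiv_sum pderiv_mult sum.distrib mult.commute[of "pderiv _"]
      add.commute)

text \<open>Combining the rows of one Sylvester block amounts to multiplying its polynomial by a
  cofactor. The reversed index reflects that the highest shift comes first.\<close>

lemma sum_smult_monom_eq:
  fixes P :: "'a::comm_ring_1 poly"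
  assumes "P = 0 \<or> degree P < n"
  shows "(\<Sum>l<n. smult (coeff P (n - 1 - l)) (monom 1 (n - 1 - l) * q)) = P * q"
proof -
  have "(\<Sum>l<n. smult (coeff P (n - 1 - l)) (monom 1 (n - 1 - l) * q)) =
      (\<Sum>l<n. smult (coeff P l) (monom 1 l * q))"
    using sum.nat_diff_reindex[of "\<lambda>l. smult (coeff P l) (monom 1 l * q)" n] by simp
  also have "\<dots> = (\<Sum>l<n. monom (coeff P l) l) * q"
    by (simp add: sum_distrib_right smult_monom flip: smult_monom[of _ 1] mult_smult_left)
  also have "(\<Sum>l<n. monom (coeff P l) l) = P"
    by (rule poly_eqI) (use assms in \<open>auto simp: coeff_sum coeff_eq_0\<close>)
  finally show ?thesis .
qed

text \<open>The Sylvester rows \<open>z\<^sup>i h\<close>, \<open>m - k \<le> i < m\<close>, are replaced by \<open>z\<^sup>j (A h - B g)\<close>, \<open>j < k\<close>.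
  As \<open>A\<close> has degree \<open>m - k\<close> this is a triangular operation with constant diagonal.\<close>

lemma det_replaced_sylvester_rows:
  fixes g h A B :: "'a::comm_ring_1 poly"
  assumes A: "degree A + k = degree g"
    and B: "B = 0 \<or> degree B + k \<le> degree h"
  shows "det (rows_mat (degree h + degree g)
           (\<lambda>i. if i < k then monom 1 (k - 1 - i) * (A * h - B * g) else sylvester_row h g i))
         = lead_coeff A ^ k * resultant h g"
proof -
  define m e n where "m = degree g" and "e = degree h" and "n = e + m"
  define P where "P i = monom 1 (k - 1 - i) * A" for i
  define P' where "P' i = monom 1 (k - 1 - i) * B" for i
  \<comment> \<open>\<open>Q\<close> is the row operation: row \<open>i < k\<close> holds the
    cofactor \<open>P i\<close> on the \<open>m\<close> rows of \<open>h\<close> and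
    \<open>- P' i\<close> on the \<open>e\<close> rows of \<open>g\<close>; the other rows are those
    of the identity.\<close>
  define Q where "Q = mat n n (\<lambda>(i, l). if i < k
     then (if l < m then coeff (P i) (m - 1 - l) else - coeff (P' i) (n - 1 - l))
     else if i = l then 1 else 0)"
  have k: "k \<le> m" using A by (simp add: m_def)
  have Qc: "Q \<in> carrier_mat n n" by (simp add: Q_def)
  have row: "(\<Sum>l<n. smult (Q $$ (i, l)) (sylvester_row h g l)) =
      (if i < k then monom 1 (k - 1 - i) * (A * h - B * g) else sylvester_row h g i)"
    if i: "i < n" for i
  proof (cases "i < k")
    case True
    have dP: "degree (P i) < m"
    proof -
      have "degree (P i) \<le> (k - 1 - i) + degree A"
        unfolding P_def by (rule order_trans[OF degree_mult_le]) (simp add: degree_monom_le)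
      then show ?thesis using True A by (simp add: m_def)
    qed
    have dP': "P' i = 0 \<or> degree (P' i) < e"
    proof (cases "B = 0")
      case False
      have "degree (P' i) \<le> (k - 1 - i) + degree B"
        unfolding P'_def by (rule order_trans[OF degree_mult_le]) (simp add: degree_monom_le)
      then show ?thesis using True B False unfolding e_def by linarith
    qed (simp add: P'_def)
    have "(\<Sum>l<n. smult (Q $$ (i, l)) (sylvester_row h g l)) =
        (\<Sum>l<m. smult (Q $$ (i, l)) (sylvester_row h g l)) +
        (\<Sum>l<e. smult (Q $$ (i, m + l)) (sylvester_row h g (m + l)))"
      unfolding n_def add.commute[of e m] by (induction e) (simp_all add: add.assoc)
    also have "(\<Sum>l<m. smult (Q $$ (i, l)) (sylvester_row h g l)) =
        (\<Sum>l<m. smult (coeff (P i) (m - 1 - l)) (monom 1 (m - 1 - l) * h))"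
      using i True by (intro sum.cong) (auto simp: Q_def sylvester_row_def n_def m_def)
    also have "\<dots> = P i * h" using dP by (intro sum_smult_monom_eq) auto
    also have "(\<Sum>l<e. smult (Q $$ (i, m + l)) (sylvester_row h g (m + l))) =
        (\<Sum>l<e. - smult (coeff (P' i) (e - 1 - l)) (monom 1 (e - 1 - l) * g))"
      using i True by (intro sum.cong) (auto simp: Q_def sylvester_row_def n_def m_def e_def)
    also have "\<dots> = - (P' i * g)"
      using sum_smult_monom_eq[OF dP', of g] by (simp add: sum_negf)
    finally show ?thesis using True by (simp add: P_def P'_def algebra_simps)
  next
    case False
    then have "(\<Sum>l<n. smult (Q $$ (i, l)) (sylvester_row h g l)) =
       (\<Sum>l<n. if i = l then sylvester_row h g l else 0)"
      using i by (intro sum.cong) (auto simp: Q_def)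
    then show ?thesis using False i by simp
  qed
  have "upper_triangular Q"
  proof (rule upper_triangularI)
    fix l i assume "l < i" "i < dim_row Q"
    then have i: "i < n" "l < i" by (auto simp: Q_def)
    show "Q $$ (i, l) = 0"
    proof (cases "i < k")
      case True
      \<comment> \<open>The entry is the coefficient of \<open>A\<close> of index
        \<open>degree A + (i - l)\<close>: zero left of the diagonal, the leading coefficient on
        it.\<close>
      have "degree A < m - 1 - l - (k - 1 - i)" using A True i k by (simp add: m_def)
      then show ?thesis
        using i True k by (auto simp: Q_def P_def coeff_monom_mult coeff_eq_0)
    qed (use i in \<open>auto simp: Q_def\<close>)
  qed
  then have "det Q = prod_list (diag_mat Q)" using Qc by (rule det_upper_triangular)
  also have "\<dots> = (\<Prod>i<n. Q $$ (i, i))"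
    using Qc by (simp add: diag_mat_def prod.distinct_set_conv_list[symmetric] atLeast0LessThan)
  also have "\<dots> = (\<Prod>i<n. if i < k then lead_coeff A else 1)"
  proof (intro prod.cong refl)
    fix i assume "i \<in> {..<n}"
    then have i: "i < n" by simp
    show "Q $$ (i, i) = (if i < k then lead_coeff A else 1)"
    proof (cases "i < k")
      case True
      have "m - 1 - i - (k - 1 - i) = degree A" using A True k by (simp add: m_def)
      then show ?thesis
        using i True k by (auto simp: Q_def P_def coeff_monom_mult)
    qed (use i in \<open>auto simp: Q_def\<close>)
  qed
  also have "\<dots> = (\<Prod>i<k. lead_coeff A)"
    using k by (intro prod.mono_neutral_cong_right) (auto simp: n_def)
  finally have dQ: "det Q = lead_coeff A ^ k" by simp
  have "Q * sylvester_mat h g = rows_mat n (\<lambda>i. \<Sum>l<n. smult (Q $$ (i, l)) (sylvester_row h g l))"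
    using mult_rows_mat[OF Qc] by (simp add: sylvester_mat_eq_rows n_def m_def e_def)
  also have "\<dots> = rows_mat n (\<lambda>i. if i < k then monom 1 (k - 1 - i) * (A * h - B * g)
      else sylvester_row h g i)"
    unfolding rows_mat_def by (intro cong_mat refl) (simp add: row)
  finally show ?thesis
    using det_mult[OF Qc, of "sylvester_mat h g"] dQ sylvester_carrier_mat[of h g]
    by (simp add: n_def m_def e_def resultant_def)
qed

text \<open>A relation between the rows reads \<open>V1 E + V2 d B + V3 d A = 0\<close> with
  \<open>V1\<close> and \<open>V2\<close> of degree less than \<open>d\<close> and \<open>A\<close>,
  or zero. Then \<open>d\<close> divides \<open>V1\<close>, so \<open>V1 = 0\<close>; then
  \<open>A\<close> divides \<open>V2\<close>, so \<open>V2 = 0\<close>, and \<open>V3 = 0\<close>.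
  The number \<open>e\<close> only bounds the degree of \<open>d * B\<close>, which allows a degree
  drop on the fibre.\<close>

lemma replaced_sylvester_rows_nonzero:
  fixes d A B E :: "complex poly"
  assumes nz: "d \<noteq> 0" "A \<noteq> 0" and AB: "coprime A B" and dE: "coprime d E"
    and B: "B = 0 \<or> degree (d * B) \<le> e"
    and E: "E = 0 \<or> degree E + degree d \<le> degree (d * A) + e"
    and k: "k = degree d" and m: "m = degree (d * A)" and n: "n = e + m"
  shows "det (rows_mat n (\<lambda>i. if i < k then monom 1 (k - 1 - i) * E
           else if i < m then monom 1 (m - 1 - i) * (d * B) else monom 1 (n - 1 - i) * (d * A))) \<noteq> 0"
    (is "det (rows_mat n ?r) \<noteq> 0")
proof (rule det_rows_mat_nonzero)
  have mk: "m = k + degree A" using nz by (simp add: m k degree_mult_eq)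
  have deg: "monom 1 j * p = 0 \<or> degree (monom 1 j * p) < n"
    if "p = 0 \<or> j + degree p < n" for j and p :: "complex poly"
    using that by (cases "p = 0") (auto simp: degree_mult_eq degree_monom_eq monom_eq_0_iff)
  show "?r i = 0 \<or> degree (?r i) < n" if i: "i < n" for i
  proof (cases "i < k")
    case True
    have "E = 0 \<or> k - 1 - i + degree E < n" using E True by (auto simp: n k m)
    then show ?thesis using deg[of E] True by simp
  next
    case False
    have 1: "d * B = 0 \<or> m - 1 - i + degree (d * B) < n" if "i < m" using B that by (auto simp: n)
    have 2: "n - 1 - i + degree (d * A) < n" if "\<not> i < m" using i that by (auto simp: n m)
    show ?thesis
    proof (cases "i < m")
      case True then show ?thesis using deg[of "d * B", OF 1] False by simp
    next
      case False': False
      then show ?thesis using deg[of "d * A" "n - 1 - i"] 2 False by simp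
    qed
  qed
  fix v assume sum0: "(\<Sum>i<n. smult (v i) (?r i)) = 0"
  \<comment> \<open>The cofactor formed from the entries of \<open>v\<close> in the block of rows
    from \<open>l\<close> to \<open>u - 1\<close>.\<close>
  define V where "V l u = (\<Sum>i\<in>{l..<u}. monom (v i) (u - 1 - i))" for l u
  have coeffV: "coeff (V l u) (u - 1 - i) = v i" if "i \<in> {l..<u}" for l u i
  proof -
    have "coeff (V l u) (u - 1 - i) = (\<Sum>j\<in>{l..<u}. if j = i then v j else 0)"
      unfolding V_def coeff_sum using that by (intro sum.cong) auto
    then show ?thesis using that by simp
  qed
  have degV: "degree (V l u) < u - l" if "l < u" for l u
  proof -
    have "degree (V l u) \<le> u - l - 1"
      unfolding V_def by (intro degree_sum_le) (auto intro!: order_trans[OF degree_monom_le])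
    then show ?thesis using that by simp
  qed
  \<comment> \<open>This includes the empty block, where no degree is less than
    \<open>u - l = 0\<close>.\<close>
  have V0: "V l u = 0" if "V l u = 0 \<or> u - l \<le> degree (V l u)" for l u
    using degV[of l u] that by (cases "l < u") (auto simp: V_def)
  have smul: "(\<Sum>i\<in>{l..<u}. smult (v i) (monom 1 (u - 1 - i) * p)) = V l u * p" for l u p
    unfolding V_def sum_distrib_right by (intro sum.cong) (auto simp flip: mult_smult_left simp: smult_monom)
  have split: "sum f {..<n} = sum f {0..<k} + sum f {k..<m} + sum f {m..<n}" if "k \<le> m" "m \<le> n"
    for f :: "nat \<Rightarrow> complex poly"
    using that sum.atLeastLessThan_concat[of 0 k m f] sum.atLeastLessThan_concat[of 0 m n f]
    by (simp add: atLeast0LessThan)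
  have "(\<Sum>i<n. smult (v i) (?r i)) = (\<Sum>i\<in>{0..<k}. smult (v i) (?r i)) +
      (\<Sum>i\<in>{k..<m}. smult (v i) (?r i)) + (\<Sum>i\<in>{m..<n}. smult (v i) (?r i))"
    using mk n by (intro split) auto
  also have "(\<Sum>i\<in>{0..<k}. smult (v i) (?r i)) = V 0 k * E"
    unfolding smul[symmetric] by (intro sum.cong) auto
  also have "(\<Sum>i\<in>{k..<m}. smult (v i) (?r i)) = V k m * (d * B)"
    unfolding smul[symmetric] by (intro sum.cong) auto
  also have "(\<Sum>i\<in>{m..<n}. smult (v i) (?r i)) = V m n * (d * A)"
    unfolding smul[symmetric] using mk by (intro sum.cong) auto
  finally have rel: "V 0 k * E + V k m * (d * B) + V m n * (d * A) = 0" using sum0 by simp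
  then have "V 0 k * E = d * (- (V k m * B) - V m n * A)" by (simp add: algebra_simps eq_neg_iff_add_eq_0)
  then have "d dvd V 0 k * E" by simp
  then have "d dvd V 0 k" using coprime_dvd_mult_left_iff[OF dE] by simp
  then have V1: "V 0 k = 0"
    using V0[of 0 k] dvd_imp_degree_le[of d "V 0 k"] unfolding k by linarith
  then have "d * (V k m * B + V m n * A) = 0" using rel by (simp add: algebra_simps)
  then have rel2: "V k m * B + V m n * A = 0" using nz by simp
  then have "V k m * B = A * - V m n" by (simp add: algebra_simps eq_neg_iff_add_eq_0)
  then have "A dvd V k m * B" by (metis dvd_triv_left)
  then have "A dvd V k m" using coprime_dvd_mult_left_iff[OF AB] by simp
  then have V2: "V k m = 0"
    using V0[of k m] dvd_imp_degree_le[of A "V k m"] unfolding mk by linarith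
  with rel2 nz have V3: "V m n = 0" by simp
  show "\<forall>i<n. v i = 0"
  proof (intro allI impI)
    fix i assume "i < n"
    then consider "i \<in> {0..<k}" | "i \<in> {k..<m}" | "i \<in> {m..<n}" by fastforce
    then show "v i = 0" by cases (use coeffV V1 V2 V3 in force)+
  qed
qed

text \<open>\<open>tr\<close> says that the Jacobian determinant is nonzero at each common zero on
  the fibre \<open>y = t\<close>. By \<open>lc\<close> the degree of \<open>g\<close> is kept on the
  fibre; that of \<open>h\<close> may drop.\<close>

theorem order_resultant_transversal:
  fixes g h :: "complex poly poly"
  assumes lc: "poly (lead_coeff g) t \<noteq> 0"
    and tr: "\<And>c. eval2 g t c = 0 \<Longrightarrow> eval2 h t c = 0 \<Longrightarrow>
      eval2 (pderiv g) t c * eval2 (map_poly pderiv h) t c \<noteq>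
      eval2 (pderiv h) t c * eval2 (map_poly pderiv g) t c"
  shows "order t (resultant g h) = card {c. eval2 g t c = 0 \<and> eval2 h t c = 0}"
proof -
  interpret evp: map_poly_comm_ring_hom "\<lambda>p::complex poly. poly p t" ..
  define spec where "spec = map_poly (\<lambda>p::complex poly. poly p t)"
  note at_hom = evp.hom_mult[folded spec_def] evp.hom_minus[folded spec_def] evp.hom_add[folded spec_def]
  have coeff_at: "coeff (spec p) i = poly (coeff p i) t" for p i by (simp add: spec_def coeff_map_poly)
  have eval_at: "eval2 p t c = poly (spec p) c" for p c by (simp add: spec_def eval2_alt)
  have degg: "degree (spec g) = degree g"
    using lc by (intro antisym) (auto simp: coeff_at spec_def degree_map_poly_le intro!: le_degree)
  have degh: "degree (spec h) \<le> degree h" by (simp add: spec_def degree_map_poly_le)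
  have g0: "spec g \<noteq> 0" using lc coeff_at[of g "degree g"] by auto
  define d where "d = gcd (spec g) (spec h)"
  have d0: "d \<noteq> 0" using g0 by (simp add: d_def)
  obtain A0 B0 where AB: "spec g = A0 * d" "spec h = B0 * d" "coprime A0 B0"
    using gcd_coprime_exists[OF d0[unfolded d_def]] unfolding d_def by blast
  have A0: "A0 \<noteq> 0" using AB g0 by auto
  define k where "k = degree d"
  \<comment> \<open>The cofactors are lifted as constants in \<open>y\<close>, so their
    \<open>y\<close>-derivatives vanish and \<open>lead_coeff A\<close> is a nonzero
    constant.\<close>
  define A where "A = map_poly (\<lambda>c. [:c:]) A0"
  define B where "B = map_poly (\<lambda>c. [:c:]) B0"
  have coeffAB: "coeff A i = [:coeff A0 i:]" "coeff B i = [:coeff B0 i:]" for i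
    by (simp_all add: A_def B_def coeff_map_poly)
  have atAB: "spec A = A0" "spec B = B0" by (simp_all add: poly_eq_iff coeff_at coeffAB)
  have dtAB: "map_poly pderiv A = 0" "map_poly pderiv B = 0"
    by (simp_all add: poly_eq_iff coeff_map_poly coeffAB)
  have degA: "degree A = degree A0" "degree B = degree B0"
    by (simp_all add: A_def B_def degree_map_poly)
  have Ak: "degree A + k = degree g"
    using A0 d0 by (simp add: degA k_def AB(1) degree_mult_eq flip: degg)
  have Bk: "B = 0 \<or> degree B + k \<le> degree h"
  proof (cases "B0 = 0")
    case True then show ?thesis by (simp add: B_def)
  next
    case False
    then show ?thesis using degh d0 by (simp add: AB(2) degA k_def degree_mult_eq)
  qed
  define F where "F = A * h - B * g"
  have "spec F = 0" by (simp add: F_def at_hom atAB AB)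
  then have "poly (coeff F i) t = 0" for i by (metis coeff_at coeff_0)
  then have "[:[:- t, 1:]:] dvd F" by (simp add: const_poly_dvd_iff poly_eq_0_iff_dvd)
  then obtain E where "F = [:[:- t, 1:]:] * E" by blast
  then have E: "F = smult [:- t, 1:] E" by simp
  \<comment> \<open>Differentiating \<open>F = (y - t) E\<close> in \<open>y\<close> on the fibre
    gives \<open>E = A h_y - B g_y\<close>. At a root of \<open>d\<close> also
    \<open>g_z = A d'\<close> and \<open>h_z = B d'\<close>, so the Jacobian determinant is
    \<open>d' E\<close>.\<close>
  have root: "poly (pderiv d) c \<noteq> 0 \<and> poly (spec E) c \<noteq> 0" if c: "poly d c = 0" for c
  proof -
    have "eval2 g t c = 0" "eval2 h t c = 0" using c by (simp_all add: eval_at AB)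
    note tr = tr[OF this]
    have pd: "spec (pderiv p) = pderiv (spec p)" for p
      by (rule poly_eqI) (simp add: coeff_at coeff_pderiv)
    have gz: "eval2 (pderiv g) t c = poly A0 c * poly (pderiv d) c"
      "eval2 (pderiv h) t c = poly B0 c * poly (pderiv d) c"
      using c by (simp_all add: eval_at pd AB pderiv_mult)
    have "map_poly pderiv F = A * map_poly pderiv h - B * map_poly pderiv g"
    proof -
      have "map_poly pderiv (p - q) = map_poly pderiv p - map_poly pderiv q" for p q :: "complex poly poly"
        by (rule poly_eqI) (simp add: coeff_map_poly pderiv_diff)
      then show ?thesis by (simp add: F_def map_poly_pderiv_mult dtAB)
    qed
    moreover have "map_poly pderiv F = E + smult [:- t, 1:] (map_poly pderiv E)"
      unfolding E by (rule poly_eqI) (simp add: coeff_map_poly pderiv_diff pderiv_smult pderiv_pCons)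
    ultimately have "E + smult [:- t, 1:] (map_poly pderiv E) =
        A * map_poly pderiv h - B * map_poly pderiv g" by simp
    then have "spec (E + smult [:- t, 1:] (map_poly pderiv E)) =
        spec (A * map_poly pderiv h - B * map_poly pderiv g)" by simp
    moreover have "spec (smult [:- t, 1:] p) = 0" for p
      by (rule poly_eqI) (simp add: coeff_at)
    ultimately have "spec E = A0 * spec (map_poly pderiv h) - B0 * spec (map_poly pderiv g)"
      by (simp add: at_hom atAB)
    then have "poly (spec E) c = poly A0 c * eval2 (map_poly pderiv h) t c
        - poly B0 c * eval2 (map_poly pderiv g) t c" by (simp add: eval_at)
    then show ?thesis using tr by (auto simp: gz algebra_simps)
  qed
  have "card {c. poly d c = 0} = k"
    unfolding k_def using d0 root by (intro rsquarefree_card_roots) auto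
  moreover have "{c. eval2 g t c = 0 \<and> eval2 h t c = 0} = {c. poly d c = 0}"
    by (auto simp: eval_at d_def poly_eq_0_iff_dvd)
  ultimately have card: "card {c. eval2 g t c = 0 \<and> eval2 h t c = 0} = k" by simp

  define n where "n = degree h + degree g"
  define r where "r i = (if i < k then monom 1 (k - 1 - i) * E else sylvester_row h g i)" for i
  \<comment> \<open>Each of the first \<open>k\<close> rows carries one factor \<open>y - t\<close>,
    which is taken out of the determinant.\<close>
  have "rows_mat n (\<lambda>i. if i < k then monom 1 (k - 1 - i) * (A * h - B * g) else sylvester_row h g i) =
    rows_mat n (\<lambda>i. smult (if i < k then [:- t, 1:] else 1) (r i))"
    by (intro arg_cong[of _ _ "rows_mat n"] ext) (auto simp: r_def E F_def[symmetric])
  then have "det (rows_mat n (\<lambda>i. smult (if i < k then [:- t, 1:] else 1) (r i))) =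
      lead_coeff A ^ k * resultant h g"
    using det_replaced_sylvester_rows[OF Ak Bk] by (simp add: n_def)
  moreover have "(\<Prod>i<n. if i < k then [:- t, 1:] else 1) = (\<Prod>i<k. [:- t, 1:])"
    using Ak by (intro prod.mono_neutral_cong_right) (auto simp: n_def)
  ultimately have main: "[:- t, 1:] ^ k * det (rows_mat n r) = lead_coeff A ^ k * resultant h g"
    by (simp add: det_rows_mat_smult)
  have degE: "spec E = 0 \<or> degree (spec E) + k \<le> degree g + degree h"
  proof (cases "E = 0")
    case False
    have "degree F \<le> max (degree (A * h)) (degree (B * g))"
      unfolding F_def by (rule degree_diff_le_max)
    moreover have "degree (A * h) \<le> degree A + degree h" by (rule degree_mult_le)
    moreover have "B * g = 0 \<or> degree (B * g) + k \<le> degree h + degree g"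
      using Bk degree_mult_le[of B g] by auto
    ultimately have "degree F + k \<le> degree g + degree h" using Ak by auto
    moreover have "degree (spec E) \<le> degree F" by (simp add: E spec_def degree_map_poly_le)
    ultimately show ?thesis by simp
  qed (simp add: spec_def)
  \<comment> \<open>On the fibre the rows of \<open>h\<close> and \<open>g\<close> become shifts of
    \<open>d * B0\<close> and \<open>d * A0\<close>. The matrix size still comes from the formal
    degree of \<open>h\<close>.\<close>
  have "det (rows_mat n (\<lambda>i. if i < k then monom 1 (k - 1 - i) * spec E
           else if i < degree (d * A0) then monom 1 (degree (d * A0) - 1 - i) * (d * B0)
           else monom 1 (n - 1 - i) * (d * A0))) \<noteq> 0"
    using degE degg degh AB(3) root
    by (intro replaced_sylvester_rows_nonzero[of d A0 B0 "spec E" "degree h"])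
      (auto simp: d0 A0 k_def n_def AB mult.commute intro!: coprime_complex_polyI)
  also have "(\<lambda>i. if i < k then monom 1 (k - 1 - i) * spec E
           else if i < degree (d * A0) then monom 1 (degree (d * A0) - 1 - i) * (d * B0)
           else monom 1 (n - 1 - i) * (d * A0)) = (\<lambda>i. spec (r i))"
  proof
    have [simp]: "spec (monom 1 j) = monom 1 j" for j by (rule poly_eqI) (simp add: coeff_at)
    have [simp]: "degree (d * A0) = degree g" "degree (A0 * d) = degree g"
      using degg by (simp_all add: AB mult.commute)
    show "(if i < k then monom 1 (k - 1 - i) * spec E
           else if i < degree (d * A0) then monom 1 (degree (d * A0) - 1 - i) * (d * B0)
           else monom 1 (n - 1 - i) * (d * A0)) = spec (r i)" for i
      by (simp add: r_def sylvester_row_def at_hom AB n_def mult.commute[of d])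
  qed
  also have "rows_mat n (\<lambda>i. spec (r i)) = map_mat (\<lambda>p. poly p t) (rows_mat n r)"
    by (rule eq_matI) (auto simp: rows_mat_def coeff_at)
  also have "det \<dots> = poly (det (rows_mat n r)) t" by (rule comm_ring_hom.hom_det) (unfold_locales, auto)
  finally have \<delta>: "poly (det (rows_mat n r)) t \<noteq> 0" .
  have lA: "lead_coeff A = [:lead_coeff A0:]" by (simp add: coeffAB degA)
  have nz: "[:- t, 1:] ^ k * det (rows_mat n r) \<noteq> 0" using \<delta> by auto
  have "order t ([:- t, 1:] ^ k * det (rows_mat n r)) = k"
    unfolding order_mult[OF nz] order_power_n_n using \<delta> by (simp add: order_0I)
  moreover have "order t (lead_coeff A ^ k * resultant h g) = order t (resultant h g)"
    using nz A0 unfolding main by (subst order_mult) (auto simp: lA order_0I)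
  ultimately have "order t (resultant h g) = k" using main by simp
  \<comment> \<open>Exchanging the arguments changes at most the sign.\<close>
  moreover have "order t (resultant g h) = order t (resultant h g)"
    using nz unfolding main by (subst resultant_swap, subst order_mult) (auto simp: order_0I)
  ultimately show ?thesis using card by simp
qed

subsection \<open>Multiplicity one implies transversality\<close>

text \<open>If a tangent vector \<open>(x', y') \<noteq> 0\<close> annihilates both differentials at \<open>(a, b)\<close>, then the derivation
  along it vanishes on the ideal of the intersection, and \<open>1\<close> together with a linear form which is
  nonzero on the vector are linearly independent modulo this ideal.\<close>

lemma aff_mult_tangent:
  assumes zero: "eval2 F a b = 0" "eval2 G a b = 0"
    and F: "eval2 (map_poly pderiv F) a b * x' + eval2 (pderiv F) a b * y' = 0"
    and G: "eval2 (map_poly pderiv G) a b * x' + eval2 (pderiv G) a b * y' = 0"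
    and nz: "x' \<noteq> 0 \<or> y' \<noteq> 0"
  shows "aff_mult F G (a, b) \<noteq> 1"
proof -
  define D where "D q = eval2 (map_poly pderiv q) a b * x' + eval2 (pderiv q) a b * y'" for q
  have D_mult: "D (p * q) = D p * eval2 q a b + eval2 p a b * D q" for p q
    by (simp add: D_def map_poly_pderiv_mult pderiv_mult algebra_simps)
  have D_add: "D (p + q) = D p + D q" for p q
  proof -
    have "map_poly pderiv (p + q) = map_poly pderiv p + map_poly pderiv q"
      by (rule poly_eqI) (simp add: coeff_map_poly pderiv_add)
    then show ?thesis by (simp add: D_def pderiv_add algebra_simps)
  qed
  have D_const: "D [:[:c:]:] = 0" for c
    by (simp add: D_def map_poly_pCons_0 pderiv_pCons)
  \<comment> \<open>A coordinate function vanishing at the point whose derivative along the vector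
    is the nonzero component \<open>x'\<close> or \<open>y'\<close>.\<close>
  define l where "l = (if x' \<noteq> 0 then [:[:- a, 1:]:] else [:[:- b:], 1:])"
  have l0: "eval2 l a b = 0" by (simp add: l_def eval2_pCons)
  have Dl: "D l \<noteq> 0"
    using nz by (auto simp: D_def l_def map_poly_pCons_0 pderiv_pCons eval2_pCons)
  have "loc_indep F G (a, b) 2 (\<lambda>i. if i = 0 then 1 else l) (\<lambda>_. 1)"
    unfolding loc_indep_def
  proof (intro conjI allI impI notI)
    fix lam :: "nat \<Rightarrow> complex"
    assume ex: "\<exists>i<2. lam i \<noteq> 0"
    assume "in_loc_ideal F G (a, b) (\<Sum>i<2. [:[:lam i:]:] * (if i = 0 then 1 else l) * (\<Prod>j\<in>{..<2} - {i}. 1))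
       (\<Prod>j<2::nat. 1)"
    then obtain r s c where c: "eval2 c a b \<noteq> 0"
      and eq: "([:[:lam 0:]:] + [:[:lam 1:]:] * l) * c = r * F + s * G"
      by (auto simp: in_loc_ideal_def numeral_2_eq_2)
    \<comment> \<open>Evaluation at the point kills \<open>l\<close>, \<open>F\<close> and
      \<open>G\<close> and isolates \<open>lam 0\<close>; applying \<open>D\<close> to the same
      identity then isolates \<open>lam 1\<close>.\<close>
    from arg_cong[OF eq, of "\<lambda>q. eval2 q a b"] have "lam 0 * eval2 c a b = 0"
      by (simp add: l0 zero eval2_pCons del: mult_pCons_left)
    with c have lam0: "lam 0 = 0" by simp
    have "D (r * F + s * G) = 0"
      using F G by (simp add: D_add D_mult zero D_def[of F] D_def[of G])
    then have "D (([:[:lam 0:]:] + [:[:lam 1:]:] * l) * c) = 0" by (simp only: eq)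
    then have "lam 1 * D l * eval2 c a b = 0"
      using lam0 by (simp add: D_add D_mult D_const l0 eval2_pCons del: mult_pCons_left)
    with c Dl have "lam 1 = 0" by simp
    with lam0 ex show False by (auto simp: less_2_cases_iff)
  qed simp
  then have "enat 2 \<le> aff_mult F G (a, b)"
    unfolding aff_mult_def by (intro Sup_upper) blast
  then show ?thesis by (auto simp: one_enat_def)
qed

lemma DERIV_eval2:
  assumes "(x has_field_derivative x') (at s)" "(y has_field_derivative y') (at s)"
  shows "((\<lambda>s. eval2 q (x s) (y s)) has_field_derivative
    (eval2 (map_poly pderiv q) (x s) (y s) * x' + eval2 (pderiv q) (x s) (y s) * y')) (at s)"
proof (induction q)
  case 0
  then show ?case by (simp add: pderiv_0)
next
  case (pCons p q)
  have "((\<lambda>s. poly p (x s) + y s * eval2 q (x s) (y s)) has_field_derivative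
     (poly (pderiv p) (x s) * x' + (y s * (eval2 (map_poly pderiv q) (x s) (y s) * x'
       + eval2 (pderiv q) (x s) (y s) * y') + y' * eval2 q (x s) (y s)))) (at s)"
    by (intro DERIV_add DERIV_mult' DERIV_chain2[OF poly_DERIV] assms pCons.IH)
  then show ?case
    by (simp add: eval2_pCons map_poly_pCons_0 pderiv_pCons algebra_simps)
qed

text \<open>The multiplicity is computed in the chart \<open>y3 = 1\<close> whenever
  \<open>c \<noteq> 0\<close>, whereas the Jacobian is taken in the chart \<open>y2 = 1\<close>. So
  a common tangent vector is carried from one chart to the other.\<close>

lemma pmult_one_imp_transversal:
  assumes F: "homog3 m F" and H: "homog3 n H"
    and zero: "eval3 F t 1 c = 0" "eval3 H t 1 c = 0"
    and mult: "pmult F H (ppt (t, 1, c)) = 1"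
  defines "f \<equiv> map_poly (\<lambda>q. poly q 1) F" and "h \<equiv> map_poly (\<lambda>q. poly q 1) H"
  shows "eval2 (pderiv f) t c * eval2 (map_poly pderiv h) t c \<noteq>
    eval2 (pderiv h) t c * eval2 (map_poly pderiv f) t c"
proof
  assume J: "eval2 (pderiv f) t c * eval2 (map_poly pderiv h) t c =
    eval2 (pderiv h) t c * eval2 (map_poly pderiv f) t c"
  define D where "D q x z = eval2 (map_poly pderiv q) t c * x + eval2 (pderiv q) t c * z" for q x z
  \<comment> \<open>With a vanishing Jacobian determinant, a vector orthogonal to one nonzero
    gradient is orthogonal to both; if both gradients vanish, any vector serves.\<close>
  have "\<exists>x' z'. (x' \<noteq> 0 \<or> z' \<noteq> 0) \<and> D f x' z' = 0 \<and> D h x' z' = 0"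
  proof -
    let ?ok = "\<lambda>x' z'. (x' \<noteq> 0 \<or> z' \<noteq> 0) \<and> D f x' z' = 0 \<and> D h x' z' = 0"
    consider "?ok (eval2 (pderiv f) t c) (- eval2 (map_poly pderiv f) t c)"
      | "?ok (eval2 (pderiv h) t c) (- eval2 (map_poly pderiv h) t c)" | "?ok 1 0"
      using J by (auto simp: D_def mult.commute)
    then show ?thesis by cases blast+
  qed
  then obtain x' z' where nz: "x' \<noteq> 0 \<or> z' \<noteq> 0" and D: "D f x' z' = 0" "D h x' z' = 0" by blast
  have f0: "eval2 f t c = 0" "eval2 h t c = 0" using zero by (simp_all add: f_def h_def eval2_map_poly_1)
  \<comment> \<open>The chosen representative is unknown up to a factor \<open>s\<close>, which
    cancels in the chart coordinates.\<close>
  define v where "v = (SOME v. v \<in> ppt (t, 1, c))"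
  have "(t, 1, c) \<in> ppt (t, 1, c)" by (auto simp: ppt_def intro!: exI[of _ 1])
  then have "v \<in> ppt (t, 1, c)" unfolding v_def by (rule someI)
  then obtain s where s: "s \<noteq> 0" "v = (s * t, s, s * c)" by (auto simp: ppt_def)
  have mult: "chart_mult F H (s * t, s, s * c) = 1" using mult s by (simp add: pmult_def v_def)
  show False
  proof (cases "c = 0")
    case True
    then have "aff_mult f h (t, c) = 1" using mult s by (simp add: chart_mult_def f_def h_def)
    moreover have "aff_mult f h (t, c) \<noteq> 1"
      using D nz unfolding D_def by (intro aff_mult_tangent[OF f0]) auto
    ultimately show False by contradiction
  next
    case False
    \<comment> \<open>The line through \<open>(t, c)\<close> with direction \<open>(x', z')\<close>
      is mapped to the chart \<open>y3 = 1\<close> by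
      \<open>(x, z) \<mapsto> (x / z, 1 / z)\<close>; the velocity of its image at \<open>0\<close>
      is \<open>(X, Y)\<close>.\<close>
    define x z where "x \<epsilon> = t + x' * \<epsilon>" and "z \<epsilon> = c + z' * \<epsilon>" for \<epsilon>
    have x: "x 0 = t" "(x has_field_derivative x') (at 0)"
      and z: "z 0 = c" "(z has_field_derivative z') (at 0)"
      unfolding x_def z_def by (auto intro!: derivative_eq_intros)
    define X Y where "X = (x' * c - t * z') / (c * c)" and "Y = - z' / (c * c)"
    have dX: "((\<lambda>\<epsilon>. x \<epsilon> / z \<epsilon>) has_field_derivative X) (at 0)"
      using DERIV_divide[OF x(2) z(2)] False by (simp add: x z X_def)
    have dY: "((\<lambda>\<epsilon>. 1 / z \<epsilon>) has_field_derivative Y) (at 0)"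
      using DERIV_divide[OF DERIV_const[of 1] z(2)] False by (simp add: z Y_def)
    have ev: "\<forall>\<^sub>F \<epsilon> in nhds 0. z \<epsilon> \<noteq> 0"
    proof -
      have "open {\<epsilon>. z \<epsilon> \<noteq> 0}" unfolding z_def by (intro open_Collect_neq continuous_intros)
      then show ?thesis using False z(1) by (auto simp: eventually_nhds intro!: exI[of _ "{\<epsilon>. z \<epsilon> \<noteq> 0}"])
    qed
    have tangent: "eval2 (map_poly pderiv (poly K 1)) (t / c) (1 / c) * X
        + eval2 (pderiv (poly K 1)) (t / c) (1 / c) * Y = 0 \<and> eval2 (poly K 1) (t / c) (1 / c) = 0"
      if K: "homog3 d K" and K0: "eval3 K t 1 c = 0"
        and DK: "D (map_poly (\<lambda>q. poly q 1) K) x' z' = 0" for d K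
    proof -
      let ?E = "\<lambda>\<epsilon>. eval2 (poly K 1) (x \<epsilon> / z \<epsilon>) (1 / z \<epsilon>)"
      let ?k = "map_poly (\<lambda>q. poly q 1) K"
      \<comment> \<open>By homogeneity \<open>K(x, 1, z) = z^d K(x / z, 1 / z, 1)\<close>. In the
        derivative at \<open>0\<close> the term from \<open>z^d\<close> drops out, as
        \<open>K\<close> vanishes at the point.\<close>
      have scale: "z \<epsilon> ^ d * ?E \<epsilon> = eval2 ?k (x \<epsilon>) (z \<epsilon>)" if "z \<epsilon> \<noteq> 0" for \<epsilon>
        using eval3_homog3_scale[OF K, of "z \<epsilon>" "x \<epsilon> / z \<epsilon>" "1 / z \<epsilon>" 1] that
        by (simp add: eval2_poly_1 eval2_map_poly_1)
      from scale[of 0] have E0: "?E 0 = 0" using False K0 by (simp add: x z eval2_map_poly_1)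
      let ?T = "eval2 (map_poly pderiv (poly K 1)) (t / c) (1 / c) * X
        + eval2 (pderiv (poly K 1)) (t / c) (1 / c) * Y"
      have "(?E has_field_derivative ?T) (at 0)"
        using DERIV_eval2[OF dX dY, of "poly K 1"] by (simp add: x z)
      from DERIV_mult'[OF DERIV_power[OF z(2), of d] this]
      have 1: "((\<lambda>\<epsilon>. z \<epsilon> ^ d * ?E \<epsilon>) has_field_derivative (c ^ d * ?T)) (at 0)"
        using E0 by (simp add: z)
      have 2: "((\<lambda>\<epsilon>. eval2 ?k (x \<epsilon>) (z \<epsilon>)) has_field_derivative 0) (at 0)"
        using DERIV_eval2[OF x(2) z(2), of ?k] DK by (simp add: x z D_def)
      have 3: "\<forall>\<^sub>F \<epsilon> in nhds 0. z \<epsilon> ^ d * ?E \<epsilon> = eval2 ?k (x \<epsilon>) (z \<epsilon>)"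
        using ev by eventually_elim (rule scale)
      have "((\<lambda>\<epsilon>. z \<epsilon> ^ d * ?E \<epsilon>) has_field_derivative 0) (at 0)"
        using 2 DERIV_cong_ev[OF refl 3 refl] by blast
      from DERIV_unique[OF 1 this] False have "?T = 0" by simp
      with E0 show ?thesis by (simp add: x z)
    qed
    have "X \<noteq> 0 \<or> Y \<noteq> 0" using nz False by (auto simp: X_def Y_def)
    then have "aff_mult (poly F 1) (poly H 1) (t / c, 1 / c) \<noteq> 1"
      using tangent[OF F zero(1)] tangent[OF H zero(2)] D unfolding f_def h_def
      by (intro aff_mult_tangent[of _ _ _ _ X Y]) auto
    moreover have "aff_mult (poly F 1) (poly H 1) (t / c, 1 / c) = 1"
      using mult s False by (simp add: chart_mult_def)
    ultimately show False by contradiction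
  qed
qed

subsection \<open>Zariski open sets of parameters\<close>

text \<open>Multiplying the defining polynomials by \<open>q\<close> defines the intersection. It is
  non-empty because a product of nonzero polynomials is nonzero somewhere.\<close>

lemma zariski_open2_restrict:
  assumes "zariski_open2 U" "U \<noteq> {}" "q \<noteq> 0"
  shows "zariski_open2 (U \<inter> {w. eval2 q (fst w) (snd w) \<noteq> 0})"
    and "U \<inter> {w. eval2 q (fst w) (snd w) \<noteq> 0} \<noteq> {}"
proof -
  obtain S where S: "U = - {(a, b). \<forall>p\<in>S. eval2 p a b = 0}"
    using assms(1) by (auto simp: zariski_open2_def)
  show "zariski_open2 (U \<inter> {w. eval2 q (fst w) (snd w) \<noteq> 0})"
    unfolding zariski_open2_def by (rule exI[of _ "(\<lambda>p. p * q) ` S"]) (auto simp: S)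
  obtain p where p: "p \<in> S" "p \<noteq> 0" using assms(2) unfolding S by fastforce
  then have "p * q \<noteq> 0" using assms(3) by simp
  then obtain a b where "eval2 (p * q) a b \<noteq> 0" using eval2_eq_0_imp_eq_0 by blast
  then have "(a, b) \<in> U \<inter> {w. eval2 q (fst w) (snd w) \<noteq> 0}" using p by (auto simp: S)
  then show "U \<inter> {w. eval2 q (fst w) (snd w) \<noteq> 0} \<noteq> {}" by blast
qed

lemma zero_on_zariski_open2:
  assumes "zariski_open2 U" "U \<noteq> {}" "\<And>w. w \<in> U \<Longrightarrow> eval2 q (fst w) (snd w) = 0"
  shows "q = 0"
  using zariski_open2_restrict(2)[OF assms(1,2), of q] assms(3) by blast

subsection \<open>Homogenization\<close>

lemma finite_totdeg2: "finite {j + degree (coeff q j) | j. coeff q j \<noteq> 0}"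
proof (rule finite_subset)
  show "{j + degree (coeff q j) | j. coeff q j \<noteq> 0} \<subseteq> (\<lambda>j. j + degree (coeff q j)) ` {..degree q}"
    by (auto intro: le_degree)
qed simp

lemma totdeg2_ge: "coeff (coeff q j) i \<noteq> 0 \<Longrightarrow> i + j \<le> totdeg2 q"
proof -
  assume nz: "coeff (coeff q j) i \<noteq> 0"
  then have "j + degree (coeff q j) \<le> totdeg2 q"
    unfolding totdeg2_def using finite_totdeg2 by (intro Max_ge) auto
  moreover have "i \<le> degree (coeff q j)" using nz by (rule le_degree)
  ultimately show ?thesis by simp
qed

lemma totdeg2_homog2:
  assumes "homog2 1 (int N) q" "q \<noteq> 0"
  shows "totdeg2 q = N"
proof (rule antisym)
  have "x \<le> N" if "x \<in> {0} \<union> {j + degree (coeff q j) | j. coeff q j \<noteq> 0}" for x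
  proof -
    have "j + degree (coeff q j) \<le> N" if "coeff q j \<noteq> 0" for j
    proof -
      have "lead_coeff (coeff q j) \<noteq> 0" using that by simp
      with assms(1) have "1 * (int (degree (coeff q j)) + int j) = int N" unfolding homog2_iff by blast
      then show ?thesis by simp
    qed
    with that show ?thesis by blast
  qed
  then show "totdeg2 q \<le> N" unfolding totdeg2_def using finite_totdeg2 by (intro Max.boundedI) auto
  obtain j i where ji: "coeff (coeff q j) i \<noteq> 0" using exists_coeff2_nonzero assms(2) by blast
  with assms(1) have "i + j = N" unfolding homog2_iff by force
  with totdeg2_ge[OF ji] show "N \<le> totdeg2 q" by simp
qed

lemma coeff_homogenize:
  "coeff (coeff (coeff (homogenize f) k) j) i =
    (if i + j + k = totdeg2 f then coeff (coeff f j) i else 0)"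
proof -
  define d where "d = totdeg2 f"
  have "coeff (coeff (coeff (homogenize f) k) j) i =
     (\<Sum>j'\<le>d. \<Sum>i'\<le>d. if j' = j then if i' = i \<and> i + j + k = d then coeff (coeff f j) i else 0 else 0)"
    unfolding homogenize_def Let_def d_def[symmetric] coeff_sum
    by (intro sum.cong refl) (auto simp: coeff_sum)
  also have "\<dots> = (\<Sum>j'\<le>d. if j' = j then \<Sum>i'\<le>d. if i' = i then if i + j + k = d then coeff (coeff f j) i else 0 else 0 else 0)"
    by (intro sum.cong refl) (auto intro!: sum.neutral sum.cong)
  also have "\<dots> = (if i + j + k = d then coeff (coeff f j) i else 0)"
    by (simp add: sum.delta)
  finally show ?thesis by (simp add: d_def)
qed

lemma homog3_homogenize: "homog3 (totdeg2 f) (homogenize f)"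
  by (auto simp: homog3_def coeff_homogenize)

lemma poly_homogenize_1: "poly (homogenize f) 1 = f"
proof (rule poly_eqI, rule poly_eqI)
  fix j i
  let ?G = "homogenize f"
  have "coeff (coeff (poly ?G 1) j) i =
      (\<Sum>k\<le>degree ?G. if i + j + k = totdeg2 f then coeff (coeff f j) i else 0)"
    by (simp add: poly_altdef coeff_sum coeff_homogenize)
  also have "\<dots> = coeff (coeff f j) i"
  proof (cases "coeff (coeff f j) i = 0")
    case False
    define k where "k = totdeg2 f - i - j"
    have k: "i + j + k = totdeg2 f" using totdeg2_ge[OF False] by (simp add: k_def)
    then have "coeff (coeff (coeff ?G k) j) i \<noteq> 0" using False by (simp add: coeff_homogenize)
    then have "coeff ?G k \<noteq> 0" by auto
    then have "k \<le> degree ?G" by (rule le_degree)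
    moreover have "i + j + l = totdeg2 f \<longleftrightarrow> l = k" for l using k by auto
    ultimately show ?thesis by simp
  next
    case True
    then show ?thesis by (simp only: if_cancel sum.neutral_const)
  qed
  finally show "coeff (coeff (poly ?G 1) j) i = coeff (coeff f j) i" .
qed

text \<open>Otherwise the projective curve would contain the line joining \<open>(0:0:1)\<close> and
  \<open>(a:b:0)\<close>, and the irreducible \<open>f\<close> would be associated to
  \<open>b y1 - a y2\<close>. Hence the fibres of the projection from \<open>(0:0:1)\<close> are
  finite on the curve.\<close>

lemma eval3_homogenize_not_identically_zero:
  assumes irred: "irreducible f"
    and not_line: "\<not> (\<exists>\<alpha> \<beta> \<gamma>. (\<alpha>, \<beta>) \<noteq> (0, 0) \<and>
      {(a, b). eval2 f a b = 0} = {(a, b). \<alpha> * a + \<beta> * b + \<gamma> = 0})"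
    and ab: "a \<noteq> 0 \<or> b \<noteq> 0"
  shows "map_poly (\<lambda>q. eval2 q a b) (homogenize f) \<noteq> 0"
proof
  let ?G = "homogenize f"
  assume "map_poly (\<lambda>q. eval2 q a b) ?G = 0"
  then have "eval2 (coeff ?G k) a b = 0" for k by (metis coeff_0 coeff_map_poly eval2_0)
  then have "eval2 (coeff ?G k) (s * a) (s * b) = 0" for k s
    using eval2_homog2_scale[OF homog2_coeff_homog3[OF homog3_homogenize]] by simp
  then have "eval3 ?G (s * a) (s * b) 1 = 0" for s by (simp add: eval3_altdef)
  then have "eval2 f (s * a) (s * b) = 0" for s by (metis eval2_poly_1 poly_homogenize_1)
  from line_form_dvd[OF this ab] obtain u where u: "f = [:[:0, b:], [:- a:]:] * u" by blast
  have l: "eval2 [:[:0, b:], [:- a:]:] x y = b * x + (- a) * y" for x y by (simp add: eval2_pCons)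
  have unit: "eval2 p x y \<noteq> 0" if p: "p dvd 1" for p x y
  proof -
    obtain v where "1 = p * v" using p by (rule dvdE)
    from arg_cong[OF this, of "\<lambda>q. eval2 q x y"] show ?thesis by auto
  qed
  \<comment> \<open>The linear form vanishes at the origin, so it is the cofactor that is a
    unit.\<close>
  from irreducibleD[OF irred u] have "u dvd 1" using unit[of _ 0 0] l[of 0 0] by fastforce
  then have "{(x, y). eval2 f x y = 0} = {(x, y). b * x + (- a) * y + 0 = 0}"
    using unit by (auto simp: u l simp del: mult_pCons_left)
  moreover have "(b, - a) \<noteq> (0, 0)" using ab by auto
  ultimately show False using not_line by blast
qed

subsection \<open>Dehomogenization\<close>

lemma poly_poly_1: "poly (poly q 1) t = eval2 q t 1"
  by (simp add: eval2_def flip: one_pCons)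

lemma poly_1_homog2_nonzero:
  assumes "homog2 1 N q" "q \<noteq> 0"
  shows "poly q 1 \<noteq> 0"
proof
  assume z: "poly q 1 = 0"
  \<comment> \<open>\<open>pCons 0 q\<close> is \<open>y2 * q\<close>; the extra factor takes care
    of the points with \<open>b = 0\<close>, which dehomogenization does not see.\<close>
  have "eval2 (pCons 0 q) a b = 0" for a b
  proof (cases "b = 0")
    case False
    then have "eval2 q a b = b ^ nat N * eval2 q (a / b) 1"
      using eval2_homog2_scale[OF assms(1), of b "a / b" 1] by simp
    moreover have "eval2 q (a / b) 1 = 0" using z by (simp add: poly_poly_1[symmetric])
    ultimately show ?thesis by (simp add: eval2_pCons)
  qed (simp add: eval2_pCons)
  from eval2_eq_0_imp_eq_0[OF this] assms(2) show False by simp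
qed

text \<open>The value at \<open>(1, 0)\<close> is the coefficient of \<open>y1^N\<close>, which
  becomes the leading coefficient at \<open>y2 = 1\<close>.\<close>

lemma degree_poly_1_homog2:
  assumes "homog2 1 (int N) q" "eval2 q 1 0 \<noteq> 0"
  shows "degree (poly q 1) = N"
proof -
  have ce: "coeff (poly q 1) i = (\<Sum>j\<le>degree q. coeff (coeff q j) i)" for i
    by (simp add: poly_altdef coeff_sum)
  have hom: "coeff (coeff q j) i = 0" if "i + j \<noteq> N" for i j
    using assms(1) that unfolding homog2_iff by force
  have q0: "coeff q 0 = monom (coeff (coeff q 0) N) N"
    by (rule poly_eqI) (use hom[of _ 0] in auto)
  have "eval2 q 1 0 = poly (coeff q 0) 1" by (cases q) (simp add: eval2_pCons)
  with assms(2) have nz: "coeff (coeff q 0) N \<noteq> 0" by (subst (asm) q0) (simp add: poly_monom)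
  have "coeff (poly q 1) N = (\<Sum>j\<le>degree q. if j = 0 then coeff (coeff q j) N else 0)"
    unfolding ce by (intro sum.cong) (auto intro: hom)
  then have "coeff (poly q 1) N \<noteq> 0" using nz by simp
  moreover have "coeff (poly q 1) i = 0" if "N < i" for i
    unfolding ce using that by (intro sum.neutral ballI hom) auto
  ultimately show ?thesis by (intro antisym degree_le le_degree) auto
qed

subsection \<open>Resultants and specialisation\<close>

lemma coeff_liftU [simp]: "coeff (liftU G) k = [:[:coeff G k:]:]"
  by (simp add: liftU_def coeff_map_poly)

lemma degree_liftU [simp]: "degree (liftU G) = degree G"
  unfolding liftU_def by (rule degree_map_poly) simp

lemma coeff_Zspec: "coeff (Zspec Z w) k = evalu w (coeff Z k)"
  by (simp add: Zspec_def coeff_map_poly evalu_def)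

lemma evalu_const [simp]: "evalu w [:[:q:]:] = q"
  by (simp add: evalu_def map_poly_pCons_0)

lemma evalu_resultant:
  assumes "degree (Zspec Z w) = degree Z"
  shows "evalu w (resultant (liftU G) Z) = resultant G (Zspec Z w)"
proof -
  interpret comm_ring_hom "evalu w" by (rule comm_ring_hom_evalu)
  have "map_poly (evalu w) (liftU G) = G"
    by (rule poly_eqI) (simp add: coeff_map_poly)
  then show ?thesis
    using resultant_map_poly[of "liftU G" Z] assms by (simp add: Zspec_def)
qed

lemma poly_1_resultant:
  assumes "degree (map_poly (\<lambda>q. poly q 1) F) = degree F" "degree (map_poly (\<lambda>q. poly q 1) H) = degree H"
  shows "poly (resultant F H) 1 = resultant (map_poly (\<lambda>q. poly q (1::'a::comm_ring_1 poly)) F) (map_poly (\<lambda>q. poly q 1) H)"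
  using assms by (intro comm_ring_hom.resultant_map_poly[symmetric]) (unfold_locales, auto)

lemma degree_map_poly_1_homog3:
  assumes "homog3 d F"
  shows "degree (map_poly (\<lambda>q. poly q 1) F) = degree F"
proof (cases "F = 0")
  case False
  then have "poly (lead_coeff F) 1 \<noteq> 0"
    by (intro poly_1_homog2_nonzero[OF homog2_coeff_homog3[OF assms]]) auto
  then have "coeff (map_poly (\<lambda>q. poly q 1) F) (degree F) \<noteq> 0" by (simp add: coeff_map_poly)
  then show ?thesis by (intro antisym degree_map_poly_le le_degree)
qed simp

text \<open>The vector of powers of \<open>c\<close> lies in the kernel of the Sylvester matrix at
  \<open>t\<close>, even if both leading coefficients vanish there.\<close>

lemma resultant_common_root:
  fixes g h :: "complex poly poly"
  assumes "eval2 g t c = 0" "eval2 h t c = 0" "degree g + degree h > 0"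
  shows "poly (resultant g h) t = 0"
proof -
  let ?n = "degree g + degree h"
  let ?M = "map_mat (\<lambda>p. poly p t) (sylvester_mat g h)"
  define v where "v = vec ?n (\<lambda>j. c ^ (?n - 1 - j))"
  let ?r = "\<lambda>i. map_poly (\<lambda>p. poly p t) (sylvester_row g h i)"
  have M: "?M \<in> carrier_mat ?n ?n" using sylvester_carrier_mat by auto
  have "?M *\<^sub>v v = 0\<^sub>v ?n"
  proof (rule eq_vecI)
    fix i assume "i < dim_vec (0\<^sub>v ?n :: complex vec)"
    then have i: "i < ?n" by simp
    have deg: "sylvester_row g h i = 0 \<or> degree (sylvester_row g h i) < ?n"
      using i degree_mult_le[of "monom 1 (degree h - 1 - i)" g]
        degree_mult_le[of "monom 1 (?n - 1 - i)" h]
      by (auto simp: sylvester_row_def degree_monom_eq)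
    have "(?M *\<^sub>v v) $ i = (\<Sum>j<?n. poly (coeff (sylvester_row g h i) (?n - 1 - j)) t * c ^ (?n - 1 - j))"
      using i by (simp add: sylvester_mat_eq_rows rows_mat_def v_def scalar_prod_def atLeast0LessThan)
    also have "\<dots> = (\<Sum>j<?n. poly (coeff (sylvester_row g h i) j) t * c ^ j)"
      using sum.nat_diff_reindex[of "\<lambda>j. poly (coeff (sylvester_row g h i) j) t * c ^ j" ?n] by simp
    also have "\<dots> = (\<Sum>j\<le>degree (sylvester_row g h i). poly (coeff (sylvester_row g h i) j) t * c ^ j)"
      using deg i by (intro sum.mono_neutral_right) (auto simp: coeff_eq_0)
    also have "\<dots> = eval2 (sylvester_row g h i) t c"
      by (simp add: eval2_def poly_altdef[of "sylvester_row g h i"] poly_sum poly_power)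
    also have "\<dots> = 0" using assms by (simp add: sylvester_row_def)
    finally show "(?M *\<^sub>v v) $ i = (0\<^sub>v ?n :: complex vec) $ i" using i by simp
  qed (use M in auto)
  moreover have "v \<in> carrier_vec ?n" by (simp add: v_def)
  moreover have "v \<noteq> 0\<^sub>v ?n"
  proof
    assume "v = 0\<^sub>v ?n"
    \<comment> \<open>The last entry is \<open>c ^ 0 = 1\<close>, also for
      \<open>c = 0\<close>.\<close>
    then have "v $ (?n - 1) = 0" using assms(3) by simp
    then show False using assms(3) by (simp add: v_def)
  qed
  ultimately have "det ?M = 0" using det_0_iff_vec_prod_zero[OF M] by blast
  moreover have "det ?M = poly (det (sylvester_mat g h)) t"
    by (rule comm_ring_hom.hom_det) (unfold_locales, auto)
  ultimately show ?thesis by (simp add: resultant_def)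
qed

subsection \<open>Homogeneity of the primitive part\<close>

text \<open>With weight \<open>0\<close> on the parameters, the grading of the resultant is that in
  the coordinates alone and gives all its coefficients the same degree.\<close>

lemma resultant_homogeneous:
  assumes G: "homog3 m G" and Z: "\<And>\<alpha>. homog3 d (Zcoeff Z \<alpha>)"
  shows "\<exists>M. \<forall>i j. homog2 1 M (coeff (coeff (resultant (liftU G) Z) i) j)"
proof -
  let ?A = "grade_poly 0 (grade_poly 0 (homog2 1))"
  have "grade_poly 1 ?A (int m) (liftU G)"
    using homog2_coeff_homog3[OF G]
    by (auto simp: grade_poly_def coeff_pCons gradedD(1)[OF graded_homog2] split: nat.split)
  moreover have "grade_poly 1 ?A (int d) Z"
    unfolding grade_poly_def
  proof (intro allI)
    fix k i j
    show "homog2 1 (int d - 1 * int k - 0 * int i - 0 * int j) (coeff (coeff (coeff Z k) i) j)"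
      using homog2_coeff_homog3[OF Z[of "(j, i)"], of k] by (simp add: Zcoeff_def coeff_map_poly)
  qed
  ultimately have "\<exists>M. ?A M (resultant (liftU G) Z)"
    by (intro graded_resultant graded_grade_poly graded_homog2)
  then show ?thesis by (auto simp: grade_poly_def)
qed

lemma homog2_degree_unique: "homog2 1 k q \<Longrightarrow> homog2 1 l q \<Longrightarrow> q \<noteq> 0 \<Longrightarrow> k = l"
  using exists_coeff2_nonzero[of q] unfolding homog2_iff by metis

lemma exists_coeff_YU_nonzero: "x \<noteq> 0 \<Longrightarrow> \<exists>i j. coeff (coeff x i) j \<noteq> (0::cpoly2)"
  by (metis coeff_0 leading_coeff_neq_0)

text \<open>Factors of forms are forms, so the content has some degree \<open>K\<close> and every
  nonzero coefficient of \<open>P\<close> has degree \<open>M - K\<close>, which is therefore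
  \<open>degy12 P\<close>.\<close>

lemma PP_u_properties:
  assumes nz: "R \<noteq> 0" and hom: "\<And>i j. homog2 1 M (coeff (coeff R i) j)"
  defines "C \<equiv> content_u R" and "P \<equiv> PP_u R"
  shows "C \<noteq> 0" "R = [:[:C:]:] * P" "\<And>i j. homog2 1 (int (degy12 P)) (coeff (coeff P i) j)"
    "\<And>p. (\<And>i j. p dvd coeff (coeff P i) j) \<Longrightarrow> p dvd 1" "\<exists>K. homog2 1 K C"
proof -
  have dvd: "C dvd coeff (coeff R i) j" for i j
    unfolding C_def content_u_def by (intro Gcd_dvd) auto
  obtain i0 j0 where ij0: "coeff (coeff R i0) j0 \<noteq> 0" using exists_coeff_YU_nonzero[OF nz] by blast
  then show C0: "C \<noteq> 0" using dvd[of i0 j0] by auto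
  have cP: "coeff (coeff P i) j = coeff (coeff R i) j div C" for i j
    by (simp add: P_def PP_u_def coeff_map_poly C_def)
  then have CP: "C * coeff (coeff P i) j = coeff (coeff R i) j" for i j using dvd by simp
  show R: "R = [:[:C:]:] * P"
    by (intro poly_eqI) (simp add: CP)
  show "p dvd 1" if p: "\<And>i j. p dvd coeff (coeff P i) j" for p
  proof -
    have "C * p dvd coeff (coeff R i) j" for i j
      using p[of i j] by (simp flip: CP)
    then have "C * p dvd C" unfolding C_def content_u_def by (intro Gcd_greatest) auto
    then obtain v where "C = C * p * v" by (rule dvdE)
    then have "C * (p * v) = C * 1" by (simp add: mult.assoc)
    then have "p * v = 1" using C0 by (simp only: mult_cancel_left) simp
    then show ?thesis by (metis dvd_triv_left)
  qed
  obtain K where K: "homog2 1 K C"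
    using homog2_factor[of M C "coeff (coeff P i0) j0"] hom[of i0 j0] ij0 by (auto simp: CP)
  then show "\<exists>K. homog2 1 K C" by blast
  have homP: "homog2 1 (M - K) (coeff (coeff P i) j)" for i j
  proof (cases "coeff (coeff P i) j = 0")
    case True
    then show ?thesis using gradedD(1)[OF graded_homog2] by simp
  next
    case False
    then have ne: "C * coeff (coeff P i) j \<noteq> 0" using C0 by simp
    obtain n where n: "homog2 1 n (coeff (coeff P i) j)"
      using homog2_factor[of M "coeff (coeff P i) j" C] hom[of i j] ne by (auto simp: CP mult.commute)
    have "K + n = M"
      using gradedD(5)[OF graded_homog2 K n] hom[of i j] ne by (intro homog2_degree_unique) (auto simp: CP)
    then show ?thesis using n by auto
  qed
  have P0: "coeff (coeff P i0) j0 \<noteq> 0" using CP[of i0 j0] ij0 by auto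
  then obtain j i where "coeff (coeff (coeff (coeff P i0) j0) j) i \<noteq> 0" using exists_coeff2_nonzero by blast
  then have "M - K \<ge> 0" using homP[of i0 j0] unfolding homog2_iff by force
  then obtain N where N: "M - K = int N" using nonneg_int_cases by blast
  \<comment> \<open>Zero coefficients contribute \<open>0\<close> to the maximum in
    \<open>degy12\<close>, all others \<open>N\<close>.\<close>
  have td: "totdeg2 (coeff (coeff P i) j) = (if coeff (coeff P i) j = 0 then 0 else N)" for i j
    using totdeg2_homog2[of N "coeff (coeff P i) j"] homP[of i j] by (simp add: N) (simp add: totdeg2_def)
  define S where "S = {totdeg2 (coeff (coeff P i) j) | i j. True}"
  have "S \<subseteq> {0, N}" using td by (auto simp: S_def)
  moreover have "totdeg2 (coeff (coeff P i0) j0) \<in> S" unfolding S_def by blast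
  then have "N \<in> S" using td[of i0 j0] P0 by simp
  ultimately have "{0} \<union> S = {0, N}" by auto
  then have "degy12 P = N" unfolding degy12_def S_def by simp
  then show "homog2 1 (int (degy12 P)) (coeff (coeff P i) j)" for i j using homP by (simp add: N)
qed

text \<open>By homogeneity a common zero of all coefficients would make \<open>b y1 - a y2\<close> a
  common factor.\<close>

lemma eval_coords_primitive_nonzero:
  assumes hom: "\<And>i j. homog2 1 N (coeff (coeff P i) j)"
    and prim: "\<And>p. (\<And>i j. p dvd coeff (coeff P i) j) \<Longrightarrow> p dvd 1" and ab: "a \<noteq> 0 \<or> b \<noteq> 0"
  shows "eval_coords a b P \<noteq> 0"
proof
  assume z: "eval_coords a b P = 0"
  have "eval2 (coeff (coeff P i) j) a b = 0" for i j
    by (simp add: z flip: coeff_eval_coords)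
  then have "eval2 (coeff (coeff P i) j) (s * a) (s * b) = 0" for i j s
    using eval2_homog2_scale[OF hom] by simp
  then have "[:[:0, b:], [:- a:]:] dvd 1" by (intro prim line_form_dvd[OF _ ab])
  then obtain v where "1 = [:[:0, b:], [:- a:]:] * v" by (rule dvdE)
  from arg_cong[OF this, of "\<lambda>q. eval2 q 0 0"] show False
    by (simp add: eval2_pCons del: mult_pCons_left)
qed

subsection \<open>Points of the projective plane\<close>

lemma ppt_scale: "s \<noteq> 0 \<Longrightarrow> ppt (s * a, s * b, s * c) = ppt (a, b, c)"
proof -
  assume s: "s \<noteq> 0"
  have sub: "ppt (s * a, s * b, s * c) \<subseteq> ppt (a, b, c)" if "s \<noteq> 0" for s a b c :: complex
  proof
    fix x assume "x \<in> ppt (s * a, s * b, s * c)"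
    then obtain t where "x = (t * s * a, t * s * b, t * s * c)" "t \<noteq> 0"
      by (auto simp: ppt_def mult.assoc)
    then show "x \<in> ppt (a, b, c)"
      using that unfolding ppt_def by (intro CollectI exI[of _ "t * s"]) simp
  qed
  moreover have "ppt (a, b, c) \<subseteq> ppt (s * a, s * b, s * c)"
    using sub[of "inverse s" "s * a" "s * b" "s * c"] s by (simp add: mult.assoc[symmetric])
  ultimately show ?thesis using s by blast
qed

lemma mem_ppt: "v \<in> ppt v"
  unfolding ppt_def by (cases v) (auto intro!: exI[of _ 1])

lemma ppt_in_pzeros_iff:
  assumes "homog3 d F" "(a, b, c) \<noteq> (0, 0, 0)"
  shows "ppt (a, b, c) \<in> pzeros F \<longleftrightarrow> eval3 F a b c = 0"
proof
  assume "ppt (a, b, c) \<in> pzeros F"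
  then obtain a' b' c' where eq: "ppt (a, b, c) = ppt (a', b', c')" "eval3 F a' b' c' = 0"
    by (auto simp: pzeros_def)
  then have "(a, b, c) \<in> ppt (a', b', c')" using mem_ppt by metis
  then obtain s where "a = s * a'" "b = s * b'" "c = s * c'" by (auto simp: ppt_def)
  then show "eval3 F a b c = 0" using eval3_homog3_scale[OF assms(1)] eq(2) by simp
next
  assume "eval3 F a b c = 0"
  then show "ppt (a, b, c) \<in> pzeros F" using assms(2) unfolding pzeros_def by blast
qed

lemma ppt_chart_inject:
  assumes "ppt (t, 1, c) = ppt (t', 1, c')"
  shows "t = t' \<and> c = c'"
proof -
  have "(t, 1, c) \<in> ppt (t', 1, c')" using mem_ppt assms by metis
  then show ?thesis by (auto simp: ppt_def)
qed

lemma homog3I: "(\<And>k. homog2 1 (int d - int k) (coeff F k)) \<Longrightarrow> homog3 d F"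
  unfolding homog3_def homog2_iff by fastforce

lemma homog3_Zspec:
  assumes "\<And>\<alpha>. homog3 d (Zcoeff Z \<alpha>)"
  shows "homog3 d (Zspec Z w)"
proof (rule homog3I)
  fix k
  have "homog2 1 (int d - int k) (coeff (coeff (coeff Z k) i) j)" for i j
    using homog2_coeff_homog3[OF assms[of "(j, i)"], of k] by (simp add: Zcoeff_def coeff_map_poly)
  then show "homog2 1 (int d - int k) (coeff (Zspec Z w) k)"
    unfolding coeff_Zspec by (rule homog2_evalu)
qed

theorem mainTheorem6:
  fixes D :: "(complex \<times> complex) set"
    and f :: cpoly2
    and G :: cpoly3
    and Z :: cpolyZ
    and \<Xi> :: "(complex \<times> complex) set"
  assumes D_def: "D = {(a, b). eval2 f a b = 0}"
    and f_irred: "irreducible f"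
    and D_not_line: "\<not> (\<exists>\<alpha> \<beta> \<gamma>. (\<alpha>, \<beta>) \<noteq> (0, 0) \<and> D = {(a, b). \<alpha> * a + \<beta> * b + \<gamma> = 0})"
    and G_def: "G = homogenize f"
    and Z_homog: "\<exists>d. \<forall>\<alpha>. homog3 d (Zcoeff Z \<alpha>)"
    and Z_dep_y3: "degree Z \<noteq> 0"
    and Xi_open: "zariski_open2 \<Xi>"
    and Xi_ne: "\<Xi> \<noteq> {}"
    and h1: "\<forall>\<omega>\<in>\<Xi>. totdeg3 (Zspec Z \<omega>) = degyH Z"
    and h2: "\<forall>\<omega>\<in>\<Xi>. coprime G (Zspec Z \<omega>)"
    and h3: "\<forall>\<omega>\<in>\<Xi>. \<forall>p \<in> (pzeros (Zspec Z \<omega>) \<inter> pzeros G)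
                  - (\<Inter>u\<in>\<Xi>. pzeros (Zspec Z u) \<inter> pzeros G).
               pmult G (Zspec Z \<omega>) p = 1"
    and h4: "(\<Inter>\<alpha>. pzeros G \<inter> pzeros (Zcoeff Z \<alpha>))
               \<subseteq> (\<Inter>u\<in>\<Xi>. pzeros (Zspec Z u) \<inter> pzeros G)"
    and h5: "\<forall>\<omega>\<in>\<Xi>. ppt (0, 0, 1) \<notin> (pzeros (Zspec Z \<omega>) \<inter> pzeros G)
                  - (\<Inter>u\<in>\<Xi>. pzeros (Zspec Z u) \<inter> pzeros G)"
  shows "\<exists>\<Xi>'. zariski_open2 \<Xi>' \<and> \<Xi>' \<noteq> {} \<and> \<Xi>' \<subseteq> \<Xi> \<and>
           (\<forall>\<omega>\<in>\<Xi>'. card ((pzeros (Zspec Z \<omega>) \<inter> pzeros G)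
                           - (\<Inter>u\<in>\<Xi>. pzeros (Zspec Z u) \<inter> pzeros G))
                      = degy12 (PP_u (resultant (liftU G) Z)))"
proof -
  define Fix where "Fix = (\<Inter>u\<in>\<Xi>. pzeros (Zspec Z u) \<inter> pzeros G)"
  define on where "on q w \<longleftrightarrow> eval2 q (fst w) (snd w) \<noteq> 0" for q :: cpoly2 and w
  obtain d where hZ: "\<And>\<alpha>. homog3 d (Zcoeff Z \<alpha>)" using Z_homog by blast
  define m where "m = totdeg2 f"
  have hG: "homog3 m G" unfolding G_def m_def by (rule homog3_homogenize)
  have hZw: "homog3 d (Zspec Z w)" for w by (rule homog3_Zspec[OF hZ])
  have Gnz: "map_poly (\<lambda>q. eval2 q a b) G \<noteq> 0" if "a \<noteq> 0 \<or> b \<noteq> 0" for a b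
    using eval3_homogenize_not_identically_zero[OF f_irred _ that] D_not_line
    unfolding G_def D_def by blast
  have G0: "G \<noteq> 0" using Gnz[of 1 0] by auto
  have finG: "finite {c. eval3 G a b c = 0}" if "a \<noteq> 0 \<or> b \<noteq> 0" for a b
    unfolding eval3_conv_eval2 by (rule poly_roots_finite[OF Gnz[OF that]])

  \<comment> \<open>Parameters that keep the degree in \<open>y3\<close>\<close>
  have "lead_coeff Z \<noteq> 0" using Z_dep_y3 by auto
  then obtain i0 j0 where "coeff (coeff (lead_coeff Z) i0) j0 \<noteq> 0"
    using exists_coeff_YU_nonzero by blast
  then obtain a0 b0 where "eval2 (coeff (coeff (lead_coeff Z) i0) j0) a0 b0 \<noteq> 0"
    using eval2_eq_0_imp_eq_0 by blast
  then have L0: "eval_coords a0 b0 (lead_coeff Z) \<noteq> 0"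
    by (metis coeff_0 coeff_eval_coords)
  \<comment> \<open>The leading coefficient at a point where it is a nonzero polynomial in the
    parameters; away from the zeros of \<open>L\<close> it survives specialisation.\<close>
  define L where "L = eval_coords a0 b0 (lead_coeff Z)"
  have degZ: "degree (Zspec Z w) = degree Z" if "on L w" for w
  proof -
    have "coeff (Zspec Z w) (degree Z) \<noteq> 0"
      using that by (auto simp: coeff_Zspec on_def L_def eval2_evalu[symmetric])
    then show ?thesis unfolding Zspec_def by (intro antisym degree_map_poly_le le_degree)
  qed

  \<comment> \<open>The resultant, its content and its primitive part\<close>
  define R where "R = resultant (liftU G) Z"
  have Rw: "evalu w R = resultant G (Zspec Z w)" if "on L w" for w
    unfolding R_def by (rule evalu_resultant[OF degZ[OF that]])
  have R0: "R \<noteq> 0"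
  proof
    assume z: "R = 0"
    \<comment> \<open>At a parameter of \<open>\<Xi>\<close> where the degree is kept,
      \<open>h2\<close> makes the specialised resultant nonzero.\<close>
    have "\<Xi> \<inter> {w. on L w} \<noteq> {}"
      using zariski_open2_restrict(2)[OF Xi_open Xi_ne L0] by (simp add: L_def on_def)
    then obtain w where w: "w \<in> \<Xi>" "on L w" by auto
    have "gcd G (Zspec Z w) = 1" using h2 w(1) by (simp add: coprime_iff_gcd_eq_1)
    then have "degree (gcd G (Zspec Z w)) = 0" by simp
    then have "resultant G (Zspec Z w) \<noteq> 0" using resultant_0_gcd by blast
    then show False using Rw[OF w(2)] z by (simp add: evalu_def)
  qed
  obtain M where "\<And>i j. homog2 1 M (coeff (coeff R i) j)"
    using resultant_homogeneous[OF hG hZ] unfolding R_def by blast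
  note PP = PP_u_properties[OF R0 this]
  define C P N where "C = content_u R" and "P = PP_u R" and "N = degy12 P"
  note PP = PP[folded C_def P_def, folded N_def]
  have P_nz: "eval_coords a b P \<noteq> 0" if "a \<noteq> 0 \<or> b \<noteq> 0" for a b
    by (rule eval_coords_primitive_nonzero[OF PP(3) PP(4) that])
  have homP: "homog2 1 (int N) (evalu w P)" for w by (rule homog2_evalu[OF PP(3)])
  have CP: "C * evalu w P = resultant G (Zspec Z w)" if "on L w" for w
  proof -
    interpret comm_ring_hom "evalu w" by (rule comm_ring_hom_evalu)
    have "evalu w R = evalu w ([:[:C:]:] * P)" using PP(2) by simp
    also have "\<dots> = C * evalu w P" by (simp only: hom_mult evalu_const)
    finally show ?thesis using Rw[OF that] by simp
  qed

  \<comment> \<open>Dehomogenization at \<open>y2 = 1\<close> and fixed points\<close>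
  define g where "g = map_poly (\<lambda>q. poly q 1) G"
  define h where "h w = map_poly (\<lambda>q. poly q 1) (Zspec Z w)" for w
  have degg: "degree g = degree G" unfolding g_def by (rule degree_map_poly_1_homog3[OF hG])
  have degh: "degree (h w) = degree Z" if "on L w" for w
    unfolding h_def using degree_map_poly_1_homog3[OF hZw] degZ[OF that] by simp
  have evg: "eval2 g t c = eval3 G t 1 c" "eval2 (h w) t c = eval3 (Zspec Z w) t 1 c" for t c w
    by (simp_all add: g_def h_def eval2_map_poly_1)
  have CP1: "poly C 1 * poly (evalu w P) 1 = resultant g (h w)" if "on L w" for w
    using arg_cong[OF CP[OF that], of "\<lambda>q. poly q 1"]
    by (simp add: poly_1_resultant degree_map_poly_1_homog3[OF hG] degree_map_poly_1_homog3[OF hZw] g_def h_def)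
  have common: "eval2 C t 1 * eval2 (evalu w P) t 1 = 0"
    if "on L w" "eval3 G t 1 c = 0" "eval3 (Zspec Z w) t 1 c = 0" for w t c
  proof -
    have "poly (resultant g (h w)) t = 0"
      using that degh Z_dep_y3 by (intro resultant_common_root[of _ _ c]) (auto simp: evg)
    then show ?thesis unfolding CP1[OF that(1), symmetric] by (simp add: poly_poly_1)
  qed
  \<comment> \<open>A fixed point over \<open>t\<close> makes \<open>C * P\<close> vanish at
    \<open>(t, 1)\<close> for all \<open>w\<close> in an open set. As \<open>C\<close> does not
    vanish there, \<open>P\<close> would vanish identically in the parameters.\<close>
  have nonfixed: "ppt (t, 1, c) \<notin> Fix" if t: "eval2 C t 1 \<noteq> 0" for t c
  proof
    assume mem: "ppt (t, 1, c) \<in> Fix"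
    have "eval2 (eval_coords t 1 P) (fst w) (snd w) = 0" if w: "w \<in> \<Xi> \<inter> {w. on L w}" for w
    proof -
      have "ppt (t, 1, c) \<in> pzeros (Zspec Z w)" "ppt (t, 1, c) \<in> pzeros G"
        using mem w unfolding Fix_def by blast+
      then have "eval3 G t 1 c = 0" "eval3 (Zspec Z w) t 1 c = 0"
        using ppt_in_pzeros_iff[OF hG, of t 1 c] ppt_in_pzeros_iff[OF hZw, of t 1 c w] by simp_all
      from common[OF _ this] w t show ?thesis by (auto simp: eval2_evalu)
    qed
    moreover have "zariski_open2 (\<Xi> \<inter> {w. on L w})" "\<Xi> \<inter> {w. on L w} \<noteq> {}"
      using zariski_open2_restrict[OF Xi_open Xi_ne L0] by (simp_all add: L_def on_def)
    ultimately have "eval_coords t 1 P = 0" by (intro zero_on_zariski_open2)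
    then show False using P_nz[of t 1] by simp
  qed

  \<comment> \<open>Exceptional fibres and the choice of the open set\<close>
  define Bad where "Bad = {t. poly (poly C 1 * poly (lead_coeff G) 1) t = 0}"
  \<comment> \<open>The non-fixed points of the curve of \<open>G\<close> over \<open>Bad\<close>
    and over \<open>(1:0)\<close>: finitely many, to be avoided by the curve of \<open>Z\<close> at
    \<open>w\<close>.\<close>
  define S1 where "S1 = (SIGMA t:Bad. {c. eval3 G t 1 c = 0 \<and> ppt (t, 1, c) \<notin> Fix})"
  define S2 where "S2 = {c. eval3 G 1 0 c = 0 \<and> ppt (1, 0, c) \<notin> Fix}"
  have "poly C 1 \<noteq> 0" using PP(1,5) poly_1_homog2_nonzero by blast
  moreover have "poly (lead_coeff G) 1 \<noteq> 0"
    using poly_1_homog2_nonzero[OF homog2_coeff_homog3[OF hG]] G0 by simp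
  ultimately have finBad: "finite Bad" unfolding Bad_def by (intro poly_roots_finite) simp
  have finS1: "finite S1" unfolding S1_def
    by (intro finite_SigmaI finBad) (use finG in \<open>auto intro: finite_subset[rotated]\<close>)
  have finS2: "finite S2" unfolding S2_def
    using finG[of 1 0] by (rule finite_subset[rotated]) auto
  \<comment> \<open>By \<open>h4\<close> a non-fixed point of the curve is no zero of some
    \<open>Zcoeff\<close>, which is a coefficient of \<open>eval_point\<close>.\<close>
  have point_nz: "eval_point Z a b c \<noteq> 0"
    if abc: "(a, b, c) \<noteq> (0, 0, 0)" "eval3 G a b c = 0" "ppt (a, b, c) \<notin> Fix" for a b c
  proof -
    obtain \<alpha> where "ppt (a, b, c) \<notin> pzeros G \<inter> pzeros (Zcoeff Z \<alpha>)"
      using h4 abc(3) unfolding Fix_def by blast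
    then have "eval3 (Zcoeff Z \<alpha>) a b c \<noteq> 0"
      using abc ppt_in_pzeros_iff[OF hG abc(1)] ppt_in_pzeros_iff[OF hZ abc(1)] by blast
    then show ?thesis using coeff_eval_point[of Z a b c "snd \<alpha>" "fst \<alpha>"] by auto
  qed
  \<comment> \<open>The factors in turn keep the degree in \<open>y3\<close>, keep
    \<open>(1:0)\<close> and the fibres in \<open>Bad\<close> from being roots of \<open>P\<close>,
    and keep the curve of \<open>Z\<close> off \<open>S1\<close> and \<open>S2\<close>.\<close>
  define Q where "Q = L * eval_coords 1 0 P * (\<Prod>t\<in>Bad. eval_coords t 1 P) *
    (\<Prod>(t, c)\<in>S1. eval_point Z t 1 c) * (\<Prod>c\<in>S2. eval_point Z 1 0 c)"
  have "Q \<noteq> 0"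
    using L0 P_nz point_nz finBad finS1 finS2
    by (auto simp: Q_def L_def S1_def[symmetric] S2_def[symmetric]) (auto simp: S1_def S2_def)
  note open_Q = zariski_open2_restrict[OF Xi_open Xi_ne this]
  show ?thesis
  proof (intro exI[of _ "\<Xi> \<inter> {w. eval2 Q (fst w) (snd w) \<noteq> 0}"] conjI ballI open_Q)
    fix w assume w: "w \<in> \<Xi> \<inter> {w. eval2 Q (fst w) (snd w) \<noteq> 0}"
    then have wL: "on L w" and w10: "eval2 (evalu w P) 1 0 \<noteq> 0"
      and wBad: "\<And>t. t \<in> Bad \<Longrightarrow> eval2 (evalu w P) t 1 \<noteq> 0"
      and wS1: "\<And>t c. (t, c) \<in> S1 \<Longrightarrow> eval3 (Zspec Z w) t 1 c \<noteq> 0"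
      and wS2: "\<And>c. c \<in> S2 \<Longrightarrow> eval3 (Zspec Z w) 1 0 c \<noteq> 0"
      using finBad finS1 finS2
      by (auto simp: Q_def on_def eval2_prod eval2_evalu eval2_eval_point split_beta)

    \<comment> \<open>Counting the points over the roots of the primitive part\<close>
    define NF where "NF = pzeros (Zspec Z w) \<inter> pzeros G - Fix"
    define p where "p = poly (evalu w P) 1"
    have degp: "degree p = N" unfolding p_def by (rule degree_poly_1_homog2[OF homP w10])
    have p0: "p \<noteq> 0" unfolding p_def using w10 by (intro poly_1_homog2_nonzero[OF homP]) auto
    define T where "T = {t. poly p t = 0}"
    define S where "S t = {c. eval2 g t c = 0 \<and> eval2 (h w) t c = 0}" for t
    have good: "eval2 C t 1 \<noteq> 0 \<and> poly (poly (lead_coeff G) 1) t \<noteq> 0" if "t \<in> T" for t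
      using that wBad[of t] by (auto simp: T_def p_def Bad_def poly_poly_1)
    have finT: "finite T" unfolding T_def by (rule poly_roots_finite[OF p0])
    have finS: "finite (S t)" for t
      using finG[of t 1] by (rule finite_subset[rotated]) (auto simp: S_def evg)
    \<comment> \<open>The point \<open>(0:0:1)\<close> is excluded by \<open>h5\<close>, those over
      \<open>(1:0)\<close> by \<open>wS2\<close> and those over \<open>Bad\<close> by
      \<open>wS1\<close>; elsewhere \<open>C \<noteq> 0\<close>, so a common zero lies over a root
      of \<open>p\<close>. Conversely \<open>nonfixed\<close> applies over such roots.\<close>
    have NF_eq: "NF = (\<lambda>(t, c). ppt (t, 1, c)) ` (SIGMA t:T. S t)"
    proof (intro equalityI subsetI)
      fix q assume q: "q \<in> NF"
      then obtain a b c where abc: "q = ppt (a, b, c)" "(a, b, c) \<noteq> (0, 0, 0)"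
        by (auto simp: NF_def pzeros_def)
      show "q \<in> (\<lambda>(t, c). ppt (t, 1, c)) ` (SIGMA t:T. S t)"
      proof (cases "b = 0")
        case b: True
        show ?thesis
        proof (cases "a = 0")
          case True
          then have "q = ppt (0, 0, 1)" using ppt_scale[of c 0 0 1] abc b by simp
          then show ?thesis using h5 w q by (auto simp: NF_def Fix_def)
        next
          case False
          then have eq: "q = ppt (1, 0, c / a)" using ppt_scale[of a 1 0 "c / a"] abc b by simp
          with q have "eval3 G 1 0 (c / a) = 0" "eval3 (Zspec Z w) 1 0 (c / a) = 0"
            using ppt_in_pzeros_iff[OF hG, of 1 0 "c / a"] ppt_in_pzeros_iff[OF hZw, of 1 0 "c / a"]
            by (auto simp: NF_def)
          moreover have "q \<notin> Fix" using q by (simp add: NF_def)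
          ultimately show ?thesis using wS2[of "c / a"] eq by (auto simp: S2_def)
        qed
      next
        case False
        then have eq: "q = ppt (a / b, 1, c / b)" using ppt_scale[of b "a / b" 1 "c / b"] abc by simp
        with q have z: "eval3 G (a / b) 1 (c / b) = 0" "eval3 (Zspec Z w) (a / b) 1 (c / b) = 0"
          using ppt_in_pzeros_iff[OF hG, of "a / b" 1 "c / b"]
            ppt_in_pzeros_iff[OF hZw, of "a / b" 1 "c / b"] by (auto simp: NF_def)
        have "q \<notin> Fix" using q by (simp add: NF_def)
        then have "a / b \<notin> Bad" using wS1[of "a / b" "c / b"] z eq by (auto simp: S1_def)
        then have "eval2 C (a / b) 1 \<noteq> 0" by (auto simp: Bad_def poly_poly_1)
        then have "a / b \<in> T" using common[OF wL z] by (simp add: T_def p_def poly_poly_1)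
        then show ?thesis using z eq by (auto simp: S_def evg intro!: image_eqI[of _ _ "(a / b, c / b)"])
      qed
    next
      fix q assume "q \<in> (\<lambda>(t, c). ppt (t, 1, c)) ` (SIGMA t:T. S t)"
      then obtain t c where tc: "q = ppt (t, 1, c)" "t \<in> T" "c \<in> S t" by auto
      then show "q \<in> NF"
        using nonfixed[of t c] good[of t] ppt_in_pzeros_iff[OF hG, of t 1 c]
          ppt_in_pzeros_iff[OF hZw, of t 1 c] by (auto simp: NF_def S_def evg)
    qed
    \<comment> \<open>All points over \<open>t\<close> are non-fixed, so \<open>h3\<close> yields
      transversality at each of them. Since \<open>C\<close> does not vanish at
      \<open>(t, 1)\<close>, the order of the resultant is that of \<open>p\<close>.\<close>
    have card_S: "card (S t) = order t p" if t: "t \<in> T" for t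
    proof -
      have "order t (resultant g (h w)) = card (S t)" unfolding S_def
      proof (rule order_resultant_transversal)
        have "lead_coeff g = poly (lead_coeff G) 1" by (simp add: degg) (simp add: g_def coeff_map_poly)
        then show "poly (lead_coeff g) t \<noteq> 0" using good[OF t] by simp
        fix c assume z: "eval2 g t c = 0" "eval2 (h w) t c = 0"
        then have "ppt (t, 1, c) \<in> NF"
          using t by (auto simp: NF_eq S_def intro!: image_eqI[of _ _ "(t, c)"])
        then have "pmult G (Zspec Z w) (ppt (t, 1, c)) = 1"
          using h3 w by (auto simp: NF_def Fix_def)
        then show "eval2 (pderiv g) t c * eval2 (map_poly pderiv (h w)) t c \<noteq>
            eval2 (pderiv (h w)) t c * eval2 (map_poly pderiv g) t c"
          using z unfolding g_def h_def
          by (intro pmult_one_imp_transversal[OF hG hZw]) (simp_all add: eval2_map_poly_1)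
      qed
      moreover have "order t (resultant g (h w)) = order t (poly C 1) + order t p"
      proof -
        have "poly C 1 * p \<noteq> 0" using \<open>poly C 1 \<noteq> 0\<close> p0 by simp
        then show ?thesis unfolding CP1[OF wL, symmetric] p_def by (rule order_mult)
      qed
      moreover have "order t (poly C 1) = 0"
        using good[OF t] by (intro order_0I) (simp add: poly_poly_1)
      ultimately show ?thesis by simp
    qed
    have "card NF = card (SIGMA t:T. S t)"
      unfolding NF_eq by (intro card_image inj_onI) (auto dest!: ppt_chart_inject)
    also have "\<dots> = (\<Sum>t\<in>T. card (S t))" using finT finS by simp
    also have "\<dots> = (\<Sum>t\<in>T. order t p)" using card_S by simp
    also have "\<dots> = degree p" unfolding T_def by (rule degree_eq_sum_order[OF p0, symmetric])
    finally have "card NF = N" using degp by simp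
    then show "card (pzeros (Zspec Z w) \<inter> pzeros G - (\<Inter>u\<in>\<Xi>. pzeros (Zspec Z u) \<inter> pzeros G)) =
        degy12 (PP_u (resultant (liftU G) Z))"
      by (simp add: NF_def Fix_def N_def P_def R_def)
  qed blast
qed

end
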